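(* Let $g=(t,a+ib,c)\in G$ with $a,b\in\mathbb R^n$, and suppose that $\alpha_k(t)\notin\pi\mathbb Z$ for each $k=1,\dots,n$. Then the kernel of $\pi'(g)$ is $$K_{\pi'(g)}(x,y)=\exp\left(i\lambda(c-bx+\tfrac12ab)\right)b'_t(x-a,y),\qquad x,y\in\mathbb R^n,$$ where $$b'_t(x,y)=\left(\tfrac\lambda\pi\right)^{n/2}\chi(t)\prod_{k=1}^n(1-e^{-2i\alpha_k(t)})^{-1/2}\exp\left(\tfrac\lambda2\,i\sum_{k=1}^n\frac{\cos\alpha_k(t)}{\sin\alpha_k(t)}(x_k^2+y_k^2)-\lambda i\sum_{k=1}^n\frac{x_ky_k}{\sin\alpha_k(t)}\right).$$
   Context: Fix integers $n,m\ge 1$ and $\lambda>0$. For $z,w\in\mathbb C^n$ put $zw:=\sum_k z_kw_k$ (bilinear), $z^2:=zz$, $|z|^2=z\bar z$, and $\omega((z,w),(z',w')):=\tfrac i2(zw'-z'w)$. Let $\alpha_1,\dots,\alpha_n$ be linear forms on $\mathbb R^m$; $t\cdot z=(e^{i\alpha_1(t)}z_1,\dots,e^{i\alpha_n(t)}z_n)$; $t^{-1}$ means $-t$. The generalized diamond group $G$ is $\mathbb R^m\times\mathbb C^n\times\mathbb R$ with $(t,z,c)\cdot(t',z',c')=(t+t',\,z+t\cdot z',\,c+c'+\tfrac12\omega((z,\bar z),(t\cdot z',\overline{t\cdot z'})))$. Square roots are principal (cut along the negative real axis). $\mathcal F_\lambda$ is the Hilbert space of holomorphic $f$ on $\mathbb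 C^n$ with $\int_{\mathbb C^n}|f(z)|^2e^{-\lambda|z|^2/2}d\mu_\lambda(z)<\infty$, $d\mu_\lambda=(2\pi)^{-n}\lambda^n\,dx\,dy$, $z=x+iy$. Fix a unitary character $\chi$ of $\mathbb R^m$; the unitary representation $\pi$ of $G$ on $\mathcal F_\lambda$ is $(\pi(t,z_0,c_0)f)(z)=\chi(t)\exp(i\lambda c_0+\tfrac\lambda2\bar z_0z-\tfrac\lambda4|z_0|^2)f(t^{-1}\cdot(z-z_0))$. The Bargmann transform is the unitary operator $\mathcal B:L^2(\mathbb R^n)\to\mathcal F_\lambda$, $(\mathcal B\phi)(z)=(\tfrac\lambda\pi)^{n/4}\int_{\mathbb R^n}\exp(-\tfrac\lambda4z^2+\lambda zx-\tfrac\lambda2x^2)\phi(x)\,dx$. The Schrödinger model of $\pi$ is $\pi'(g)=\mathcal B^{-1}\pi(g)\mathcal B$ on $L^2(\mathbb R^n)$. The kernel of $\pi'(g)$ is the function $K_{\pi'(g)}$ such that $(\pi'(g)\phi)(x)=\int_{\mathbb R^n}K_{\pi'(g)}(x,y)\phi(y)\,dy$ (for $\phi\in L^1(\mathbb R^n)\cap L^2(\mathbb R^n)$, where the integral converges absolutely). *)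

theory Defs
  imports "HOL-Analysis.Analysis" "HOL-Algebra.Group"
begin

text \<open>The dimensions n and m are the cardinalities of the index types \<open>'n\<close> and \<open>'m\<close>,
  hence at least 1.  The parameter of the Fock space is called \<open>lam\<close>.\<close>

subsection \<open>Vectors\<close>

text \<open>The bilinear (not sesquilinear) pairing \<open>zw\<close>.\<close>
definition bilin :: "complex^'n \<Rightarrow> complex^'n \<Rightarrow> complex" where
  "bilin z w = (\<Sum>k\<in>UNIV. z $ k * w $ k)"

definition cnj_vec :: "complex^'n \<Rightarrow> complex^'n" where
  "cnj_vec z = (\<chi> k. cnj (z $ k))"

definition of_real_vec :: "real^'n \<Rightarrow> complex^'n" where
  "of_real_vec x = (\<chi> k. of_real (x $ k))"

definition Complex_vec :: "real^'n \<Rightarrow> real^'n \<Rightarrow> complex^'n" where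
  "Complex_vec a b = (\<chi> k. Complex (a $ k) (b $ k))"

subsection \<open>The generalized diamond group\<close>

definition omega :: "(complex^'n) \<times> (complex^'n) \<Rightarrow> (complex^'n) \<times> (complex^'n) \<Rightarrow> complex" where
  "omega p q = \<i> / 2 * (bilin (fst p) (snd q) - bilin (fst q) (snd p))"

definition torus_act :: "('n \<Rightarrow> real^'m \<Rightarrow> real) \<Rightarrow> real^'m \<Rightarrow> complex^'n \<Rightarrow> complex^'n" where
  "torus_act \<alpha> t z = (\<chi> k. cis (\<alpha> k t) * z $ k)"

text \<open>The value of \<open>omega\<close> in the group law is a real number, see \<open>omega_cnj_vec\<close> below; \<open>Re\<close>
  only serves to change the type.\<close>
definition diamond_group ::
    "('n::finite \<Rightarrow> real^'m \<Rightarrow> real) \<Rightarrow> ((real^'m) \<times> (complex^'n) \<times> real) monoid" where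
  "diamond_group \<alpha> =
     \<lparr>carrier = UNIV,
      monoid.mult = (\<lambda>(t, z, c) (t', z', c').
        (t + t', z + torus_act \<alpha> t z',
         c + c' + Re (omega (z, cnj_vec z)
                        (torus_act \<alpha> t z', cnj_vec (torus_act \<alpha> t z'))) / 2)),
      one = (0, 0, 0)\<rparr>"

lemma omega_cnj_vec:
  "omega (z, cnj_vec z) (w, cnj_vec w) = of_real (- Im (bilin z (cnj_vec w)))"
proof -
  have "bilin w (cnj_vec z) = cnj (bilin z (cnj_vec w))"
    by (simp add: bilin_def cnj_vec_def mult.commute)
  then show ?thesis
    by (simp add: omega_def complex_eq_iff)
qed

lemma bilin_add_left: "bilin (x + y) z = bilin x z + bilin y z"
  and bilin_add_right: "bilin z (x + y) = bilin z x + bilin z y"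
  by (simp_all add: bilin_def algebra_simps sum.distrib)

lemma bilin_torus_act:
  "bilin (torus_act \<alpha> t z) (cnj_vec (torus_act \<alpha> t w)) = bilin z (cnj_vec w)"
proof -
  have "cis s * u * cnj (cis s * v) = u * cnj v" for s u v
  proof -
    have "cis s * cnj (cis s) = 1"
      by (simp add: cis_cnj cis_mult)
    then show ?thesis
      by (metis (no_types, lifting) complex_cnj_mult mult.assoc mult.left_commute mult_1)
  qed
  then show ?thesis
    unfolding bilin_def torus_act_def cnj_vec_def by (simp only: vec_lambda_beta)
qed

lemma group_diamond_group:
  fixes \<alpha> :: "'n::finite \<Rightarrow> real^'m \<Rightarrow> real"
  assumes lin: "\<And>k. linear (\<alpha> k)"
  shows "group (diamond_group \<alpha>)"
proof -
  have act_add: "torus_act \<alpha> t (z + w) = torus_act \<alpha> t z + torus_act \<alpha> t w" for t z w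
    by (simp add: torus_act_def vec_eq_iff algebra_simps)
  have act_act: "torus_act \<alpha> s (torus_act \<alpha> t z) = torus_act \<alpha> (s + t) z" for s t z
    by (simp add: torus_act_def vec_eq_iff linear_add[OF lin] mult.assoc[symmetric] cis_mult)
  have act_0: "torus_act \<alpha> 0 z = z" for z
    by (simp add: torus_act_def vec_eq_iff linear_0[OF lin])
  have cnj_add: "cnj_vec (z + w) = cnj_vec z + cnj_vec w" for z w :: "complex^'n"
    by (simp add: cnj_vec_def vec_eq_iff)
  have z0: "bilin 0 w = 0" for w :: "complex^'n"
    by (simp add: bilin_def)
  have act_shift: "bilin (torus_act \<alpha> s z) (cnj_vec (torus_act \<alpha> (s + t) w))
      = bilin z (cnj_vec (torus_act \<alpha> t w))" for s t z w
    by (simp add: act_act[symmetric] bilin_torus_act)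
  show ?thesis
  proof (rule groupI, goal_cases)
    case 1
    then show ?case by (simp add: diamond_group_def)
  next
    case 2
    then show ?case by (simp add: diamond_group_def)
  next
    case (3 x y z)
    then show ?case
      by (simp add: diamond_group_def split: prod.splits)
        (auto simp: omega_cnj_vec act_add act_act add.assoc,
          simp add: act_shift cnj_add bilin_add_left bilin_add_right add_divide_distrib
            diff_divide_distrib)
  next
    case (4 x)
    then show ?case
      by (auto simp: diamond_group_def omega_cnj_vec act_0 z0 split: prod.splits)
  next
    case (5 x)
    obtain t z c where x: "x = (t, z, c)" by (cases x) auto
    have neg: "torus_act \<alpha> s (- w) = - torus_act \<alpha> s w" for s w
      by (simp add: torus_act_def vec_eq_iff)
    have "bilin (- w) (cnj_vec w) = - of_real (\<Sum>k\<in>UNIV. (cmod (w $ k))\<^sup>2)" for w :: "complex^'n"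
      by (simp add: bilin_def cnj_vec_def complex_norm_square[symmetric] sum_negf)
    then have "Im (bilin (- w) (cnj_vec w)) = 0" for w :: "complex^'n"
      by simp
    then show ?case
      by (intro bexI[of _ "(- t, - torus_act \<alpha> (- t) z, - c)"])
        (auto simp: x diamond_group_def omega_cnj_vec)
  qed
qed

definition unitary_character :: "(real^'m \<Rightarrow> complex) \<Rightarrow> bool" where
  "unitary_character chi \<longleftrightarrow>
     continuous_on UNIV chi \<and> (\<forall>t. cmod (chi t) = 1) \<and> (\<forall>s t. chi (s + t) = chi s * chi t)"

subsection \<open>The Fock model\<close>

text \<open>Holomorphy in several variables: Frechet differentiability with complex linear derivative.\<close>
definition entire_on_Cn :: "(complex^'n \<Rightarrow> complex) \<Rightarrow> bool" where
  "entire_on_Cn f \<longleftrightarrow>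
     (\<forall>z. \<exists>f'. (f has_derivative f') (at z) \<and> (\<forall>c v. f' (c *s v) = c * f' v))"

definition fock_measure :: "real \<Rightarrow> (complex^'n) measure" where
  "fock_measure lam =
     scale_measure (ennreal (lam ^ CARD('n) / (2 * pi) ^ CARD('n))) lborel"

definition fock_space :: "real \<Rightarrow> (complex^'n \<Rightarrow> complex) set" where
  "fock_space lam =
     {f. entire_on_Cn f \<and>
         integrable (fock_measure lam) (\<lambda>z. (cmod (f z))\<^sup>2 * exp (- (lam * (norm z)\<^sup>2 / 2)))}"

definition fock_rep ::
    "real \<Rightarrow> ('n \<Rightarrow> real^'m \<Rightarrow> real) \<Rightarrow> (real^'m \<Rightarrow> complex) \<Rightarrow> (real^'m) \<times> (complex^'n) \<times> real
     \<Rightarrow> (complex^'n \<Rightarrow> complex) \<Rightarrow> (complex^'n \<Rightarrow> complex)" where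
  "fock_rep lam \<alpha> chi = (\<lambda>(t, z0, c0). \<lambda>f\<in>fock_space lam. \<lambda>z.
     chi t
     * exp (\<i> * of_real (lam * c0) + of_real (lam / 2) * bilin (cnj_vec z0) z
            - of_real (lam / 4 * (norm z0)\<^sup>2))
     * f (torus_act \<alpha> (- t) (z - z0)))"

subsection \<open>The Schroedinger model\<close>

text \<open>Square-integrable functions are not identified modulo null sets here: elements of the
  Hilbert space are represented by Borel functions, and equality in the Hilbert space is
  equality almost everywhere.\<close>
definition L2_fun :: "('a::euclidean_space \<Rightarrow> complex) set" where
  "L2_fun = {\<phi> \<in> borel_measurable lborel. integrable lborel (\<lambda>x. (cmod (\<phi> x))\<^sup>2)}"

definition bargmann :: "real \<Rightarrow> (real^'n \<Rightarrow> complex) \<Rightarrow> (complex^'n \<Rightarrow> complex)" where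
  "bargmann lam \<phi> = (\<lambda>z.
     of_real ((lam / pi) powr (real CARD('n) / 4))
     * (LINT x|lborel.
          exp (- of_real (lam / 4) * bilin z z + of_real lam * bilin z (of_real_vec x)
               - of_real (lam / 2 * (x \<bullet> x)))
          * \<phi> x))"

text \<open>\<open>bargmann lam\<close> is injective on \<open>L2_fun\<close> only up to null sets, so \<open>inv_into\<close>
  picks some representative of the inverse image.\<close>
definition schroedinger_rep ::
    "real \<Rightarrow> ('n::finite \<Rightarrow> real^'m \<Rightarrow> real) \<Rightarrow> (real^'m \<Rightarrow> complex) \<Rightarrow> (real^'m) \<times> (complex^'n) \<times> real
     \<Rightarrow> (real^'n \<Rightarrow> complex) \<Rightarrow> (real^'n \<Rightarrow> complex)" where
  "schroedinger_rep lam \<alpha> chi g \<phi> =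
     inv_into L2_fun (bargmann lam) (fock_rep lam \<alpha> chi g (bargmann lam \<phi>))"

definition has_kernel ::
    "(('a::euclidean_space \<Rightarrow> complex) \<Rightarrow> ('a \<Rightarrow> complex)) \<Rightarrow> ('a \<Rightarrow> 'a \<Rightarrow> complex) \<Rightarrow> bool" where
  "has_kernel T K \<longleftrightarrow>
     (\<forall>\<phi>\<in>L2_fun. integrable lborel \<phi> \<longrightarrow>
        (\<forall>x. integrable lborel (\<lambda>y. K x y * \<phi> y)) \<and>
        (AE x in lborel. T \<phi> x = (LINT y|lborel. K x y * \<phi> y)))"

definition torus_kernel ::
    "real \<Rightarrow> ('n::finite \<Rightarrow> real^'m \<Rightarrow> real) \<Rightarrow> (real^'m \<Rightarrow> complex) \<Rightarrow> real^'m
     \<Rightarrow> real^'n \<Rightarrow> real^'n \<Rightarrow> complex" where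
  "torus_kernel lam \<alpha> chi t x y =
     of_real ((lam / pi) powr (real CARD('n) / 2)) * chi t
     * (\<Prod>k\<in>UNIV. inverse (csqrt (1 - exp (- 2 * \<i> * of_real (\<alpha> k t)))))
     * exp (of_real (lam / 2) * \<i> *
              of_real (\<Sum>k\<in>UNIV. cos (\<alpha> k t) / sin (\<alpha> k t) * ((x $ k)\<^sup>2 + (y $ k)\<^sup>2))
            - of_real lam * \<i> * of_real (\<Sum>k\<in>UNIV. x $ k * y $ k / sin (\<alpha> k t)))"

end

theory Submission
  imports Defs "HOL-Probability.Distributions" "HOL-Real_Asymp.Real_Asymp"
begin

text \<open>Let \<open>\<psi>\<close> be the function obtained by applying the claimed kernel to \<open>\<phi>\<close>. By Fubini, its
  Bargmann transform is a Gaussian integral in \<open>x\<close> with complex parameters, which factors over the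
  coordinates and evaluates to the Fock representation applied to the Bargmann transform of \<open>\<phi>\<close>.
  Since \<open>inv_into\<close> picks an arbitrary preimage, the claim follows once the Bargmann transform is
  known to be injective up to null sets, \<open>\<psi>\<close> to be square-integrable, and the transform of \<open>\<phi>\<close> to lie
  in the Fock space. All three reduce to Fourier analysis: up to chirps and Gaussian weights both \<open>\<psi>\<close>
  and the Bargmann transform are Fourier integrals, for which the \<open>L\<^sup>2\<close> bound is obtained by Gaussian
  damping and the injectivity by Gaussian convolution.\<close>

subsection \<open>Differentiation under the integral sign\<close>


text \<open>The kernel has constant modulus, so it is not absolutely integrable in either variable,
  and no estimate of its modulus alone shows that it preserves square-integrability. Fubini applies
  only after multiplication by the Bargmann kernel, whose Gaussian gives the coefficient
  \<open>p\<close> of the quadratic term in x the real part lam/2.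

  The constants fit because of one identity: with w = 1 - exp(-2i\<theta>), the product w * p equals
  lam. The factor \<open>inverse (csqrt w)\<close> of the kernel therefore cancels the factor 1 /
  \<open>csqrt p\<close> of the Gaussian integral, up to the constant sqrt lam, provided that the
  branches agree. They do because w and p both lie in the open right half-plane. The argument is
  carried out one coordinate at a time, since the principal root of a product over several
  coordinates may differ in sign from the product of the roots. Accordingly the Gaussian formula is
  proved with the principal root of a complex \<open>p\<close>, and not merely up to sign.\<close>

text \<open>The quadratic bound uses only the rate r/2, so that a second factor exp(rL/2) still fits
  under exp(rL). The constant 8 comes from x^2/2 \<le> exp x at x = rL/2.\<close>

lemma exp_ge_quadratic_bounds:
  fixes r L :: real
  assumes "r > 0" "L \<ge> 0"
  shows "L \<le> exp (r * L) / r" "L\<^sup>2 \<le> 8 / r\<^sup>2 * exp (r / 2 * L)"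
proof -
  have "r * L \<le> exp (r * L)"
    using exp_ge_add_one_self[of "r * L"] by linarith
  with assms show "L \<le> exp (r * L) / r" by (simp add: field_simps)
  have "(r / 2 * L)\<^sup>2 / 2 \<le> exp (r / 2 * L)"
    using exp_lower_Taylor_quadratic[of "r / 2 * L"] assms
    by (smt (verit) mult_nonneg_nonneg divide_nonneg_nonneg)
  with assms show "L\<^sup>2 \<le> 8 / r\<^sup>2 * exp (r / 2 * L)"
    by (simp add: field_simps)
qed

text \<open>Integrability against exp(rL) leaves enough room to bound the Taylor remainder by |h|^2
  times a fixed integrable function. The exponent is only real-linear in a vector of an arbitrary
  normed space, so the lemma covers both a complex parameter of a Gaussian and the variable of the
  Bargmann transform. Differentiating at 0 is enough: any other base point is absorbed into
  \<open>k\<close>.\<close>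

lemma has_derivative_integral_exp:
  fixes l :: "'v::real_normed_vector \<Rightarrow> 'a \<Rightarrow> complex" and k :: "'a \<Rightarrow> complex"
  assumes lin: "\<And>x. linear (\<lambda>v. l v x)"
    and bound: "\<And>v x. cmod (l v x) \<le> norm v * L x"
    and L: "\<And>x. L x \<ge> 0" and r: "r > 0"
    and [measurable]: "k \<in> borel_measurable M" "L \<in> borel_measurable M" "\<And>v. l v \<in> borel_measurable M"
    and int: "integrable M (\<lambda>x. cmod (k x) * exp (r * L x))"
  shows "((\<lambda>v. \<integral>x. k x * exp (l v x) \<partial>M) has_derivative (\<lambda>v. \<integral>x. k x * l v x \<partial>M)) (at 0)"
proof -
  define I where "I = (\<integral>x. cmod (k x) * exp (r * L x) \<partial>M)"
  have I0: "I \<ge> 0" unfolding I_def by simp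
  have b1: "cmod (k x * l v x) \<le> norm v / r * (cmod (k x) * exp (r * L x))" for v x
  proof -
    have "cmod (l v x) \<le> norm v * (exp (r * L x) / r)"
      using bound[of v x] exp_ge_quadratic_bounds(1)[OF r L[of x]]
      by (meson mult_left_mono norm_ge_zero order_trans)
    then have "cmod (k x) * cmod (l v x) \<le> cmod (k x) * (norm v * (exp (r * L x) / r))"
      by (rule mult_left_mono) simp
    then show ?thesis by (simp add: norm_mult mult_ac)
  qed
  have i1: "integrable M (\<lambda>x. k x * l v x)" for v
    by (rule Bochner_Integration.integrable_bound[OF integrable_mult_right[OF int, of "norm v / r"]])
      (use r in \<open>auto intro!: AE_I2 order_trans[OF b1]\<close>)
  have ik: "integrable M k"
    by (rule Bochner_Integration.integrable_bound[OF int])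
      (auto intro!: AE_I2 simp: norm_mult mult_le_cancel_left1 L r less_imp_le)
  have l0: "l 0 x = 0" for x using lin[of x] by (rule linear_0)
  have bl: "bounded_linear (\<lambda>v. \<integral>x. k x * l v x \<partial>M)"
  proof (rule bounded_linear_intro[where K="I / r"])
    show "(\<integral>x. k x * l (u + v) x \<partial>M) = (\<integral>x. k x * l u x \<partial>M) + (\<integral>x. k x * l v x \<partial>M)" for u v
      by (simp add: linear_add[OF lin] distrib_left i1 flip: Bochner_Integration.integral_add)
    show "(\<integral>x. k x * l (c *\<^sub>R v) x \<partial>M) = c *\<^sub>R (\<integral>x. k x * l v x \<partial>M)" for c v
      by (simp add: linear_scale[OF lin])
    show "norm (\<integral>x. k x * l v x \<partial>M) \<le> norm v * (I / r)" for v
    proof -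
      have "norm (\<integral>x. k x * l v x \<partial>M) \<le> (\<integral>x. norm v / r * (cmod (k x) * exp (r * L x)) \<partial>M)"
        using i1[of v] b1[of _ v] integrable_mult_right[OF int, of "norm v / r"]
        by (intro order_trans[OF integral_norm_bound] integral_mono) auto
      then show ?thesis by (simp add: I_def)
    qed
  qed
  \<comment> \<open>The first-order Taylor remainder is at most exp |Re w| * |w|^2. For |h| \<le>
    r/2 the exponential uses half of the available growth, and the square of \<open>L x\<close> uses
    the other half.\<close>
  have b2: "cmod (k x * (exp (l h x) - 1 - l h x)) \<le> (norm h)\<^sup>2 * (8 / r\<^sup>2) * (cmod (k x) * exp (r * L x))"
    if h: "norm h \<le> r / 2" for h x
  proof -
    let ?w = "l h x"
    have "cmod (exp ?w - (\<Sum>i\<le>1. ?w ^ i / fact i)) \<le> exp \<bar>Re ?w\<bar> * cmod ?w ^ Suc 1 / fact 1"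
      by (rule Taylor_exp)
    then have "cmod (exp ?w - 1 - ?w) \<le> exp \<bar>Re ?w\<bar> * (cmod ?w)\<^sup>2"
      by (simp add: numeral_2_eq_2 algebra_simps)
    also have "\<dots> \<le> exp (r / 2 * L x) * (norm h * L x)\<^sup>2"
    proof (intro mult_mono power_mono)
      have "\<bar>Re ?w\<bar> \<le> norm h * L x" using abs_Re_le_cmod[of ?w] bound[of h x] by linarith
      also have "\<dots> \<le> r / 2 * L x" using h L by (intro mult_right_mono)
      finally show "exp \<bar>Re ?w\<bar> \<le> exp (r / 2 * L x)" by simp
    qed (use bound in auto)
    also have "\<dots> = (norm h)\<^sup>2 * (exp (r / 2 * L x) * (L x)\<^sup>2)" by (simp add: power_mult_distrib)
    also have "\<dots> \<le> (norm h)\<^sup>2 * (exp (r / 2 * L x) * (8 / r\<^sup>2 * exp (r / 2 * L x)))"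
      using exp_ge_quadratic_bounds(2)[OF r L[of x]] by (intro mult_left_mono) auto
    also have "\<dots> = (norm h)\<^sup>2 * (8 / r\<^sup>2) * exp (r * L x)"
      by (simp add: mult_ac flip: exp_add)
    finally have "cmod (exp ?w - 1 - ?w) \<le> (norm h)\<^sup>2 * (8 / r\<^sup>2) * exp (r * L x)" .
    then have "cmod (k x) * cmod (exp ?w - 1 - ?w) \<le> cmod (k x) * ((norm h)\<^sup>2 * (8 / r\<^sup>2) * exp (r * L x))"
      by (rule mult_left_mono) simp
    then show ?thesis by (simp add: norm_mult mult_ac)
  qed
  have key: "norm ((\<integral>x. k x * exp (l (0 + h) x) \<partial>M) - (\<integral>x. k x * exp (l 0 x) \<partial>M) - (\<integral>x. k x * l h x \<partial>M))
      \<le> (norm h)\<^sup>2 * (8 / r\<^sup>2) * I" if h: "norm h \<le> r / 2" for h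
  proof -
    have i2: "integrable M (\<lambda>x. k x * (exp (l h x) - 1 - l h x))"
      by (rule Bochner_Integration.integrable_bound[OF integrable_mult_right[OF int, of "(norm h)\<^sup>2 * (8 / r\<^sup>2)"]])
        (auto intro!: AE_I2 order_trans[OF b2[OF h]])
    have "integrable M (\<lambda>x. k x * (exp (l h x) - 1 - l h x) + k x + k x * l h x)"
      using i2 i1 ik by (intro Bochner_Integration.integrable_add)
    then have i3: "integrable M (\<lambda>x. k x * exp (l h x))" by (simp add: algebra_simps)
    have "(\<integral>x. k x * exp (l (0 + h) x) \<partial>M) - (\<integral>x. k x * exp (l 0 x) \<partial>M) - (\<integral>x. k x * l h x \<partial>M)
        = (\<integral>x. k x * (exp (l h x) - 1 - l h x) \<partial>M)"
      by (simp add: l0 right_diff_distrib i3 ik i1)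
    also have "norm \<dots> \<le> (\<integral>x. (norm h)\<^sup>2 * (8 / r\<^sup>2) * (cmod (k x) * exp (r * L x)) \<partial>M)"
      using i2 b2[OF h] integrable_mult_right[OF int, of "(norm h)\<^sup>2 * (8 / r\<^sup>2)"]
      by (intro order_trans[OF integral_norm_bound] integral_mono) auto
    finally show ?thesis by (simp add: I_def)
  qed
  show ?thesis
    unfolding has_derivative_at
  proof (intro conjI bl)
    show "(\<lambda>h. norm ((\<integral>x. k x * exp (l (0 + h) x) \<partial>M) - (\<integral>x. k x * exp (l 0 x) \<partial>M) - (\<integral>x. k x * l h x \<partial>M)) / norm h)
        \<midarrow>0\<rightarrow> 0"
    proof (rule Lim_null_comparison)
      show "\<forall>\<^sub>F h in at 0. norm (norm ((\<integral>x. k x * exp (l (0 + h) x) \<partial>M) - (\<integral>x. k x * exp (l 0 x) \<partial>M)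
          - (\<integral>x. k x * l h x \<partial>M)) / norm h) \<le> norm h * (8 / r\<^sup>2 * I)"
        unfolding eventually_at
      proof (intro exI[of _ "r / 2"] conjI ballI impI)
        fix h :: 'v assume "h \<noteq> 0 \<and> dist h 0 < r / 2"
        then show "norm (norm ((\<integral>x. k x * exp (l (0 + h) x) \<partial>M) - (\<integral>x. k x * exp (l 0 x) \<partial>M)
          - (\<integral>x. k x * l h x \<partial>M)) / norm h) \<le> norm h * (8 / r\<^sup>2 * I)"
          using key[of h] by (simp add: divide_le_eq power2_eq_square mult_ac)
      qed (use r in auto)
      have "((\<lambda>h::'v. norm h * (8 / r\<^sup>2 * I)) \<longlongrightarrow> norm (0::'v) * (8 / r\<^sup>2 * I)) (at 0)"
        by (intro tendsto_intros)
      then show "((\<lambda>h::'v. norm h * (8 / r\<^sup>2 * I)) \<longlongrightarrow> 0) (at 0)" by simp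
    qed
  qed
qed

subsection \<open>Gaussian integrals with complex parameters\<close>


lemma has_bochner_integral_gauss_real:
  fixes p q :: real
  assumes p: "p > 0"
  shows "has_bochner_integral lborel (\<lambda>x. exp (- p * x\<^sup>2 + q * x)) (sqrt (pi / p) * exp (q\<^sup>2 / (4 * p)))"
proof -
  \<comment> \<open>Completing the square: the integrand is a multiple of the normal density with
    this mean and with variance 1/(2p).\<close>
  define \<mu> \<sigma> where "\<mu> = q / (2 * p)" and "\<sigma> = sqrt (1 / (2 * p))"
  have \<sigma>: "\<sigma> > 0" "\<sigma>\<^sup>2 = 1 / (2 * p)" using p by (auto simp: \<sigma>_def)
  have "has_bochner_integral lborel (\<lambda>x. normal_density \<mu> \<sigma> x * (sqrt (pi / p) * exp (q\<^sup>2 / (4 * p))))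
      (1 * (sqrt (pi / p) * exp (q\<^sup>2 / (4 * p))))"
    using \<sigma> by (intro has_bochner_integral_mult_left) (simp_all add: has_bochner_integral_iff)
  moreover have "normal_density \<mu> \<sigma> x * (sqrt (pi / p) * exp (q\<^sup>2 / (4 * p))) = exp (- p * x\<^sup>2 + q * x)" for x
  proof -
    have "- (x - \<mu>)\<^sup>2 / (2 * \<sigma>\<^sup>2) + q\<^sup>2 / (4 * p) = - p * x\<^sup>2 + q * x"
      using p unfolding \<sigma> \<mu>_def by (simp add: field_simps power2_eq_square)
    then show ?thesis
      using p by (simp add: normal_density_def \<sigma>(2) flip: exp_add)
  qed
  ultimately show ?thesis by simp
qed

lemma integrable_gauss_abs:
  fixes p q :: real
  assumes p: "p > 0"
  shows "integrable lborel (\<lambda>x. exp (- p * x\<^sup>2 + q * \<bar>x\<bar>))"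
proof (rule Bochner_Integration.integrable_bound)
  show "integrable lborel (\<lambda>x. exp (- p * x\<^sup>2 + q * x) + exp (- p * x\<^sup>2 + (- q) * x))"
    using has_bochner_integral_gauss_real[OF p]
    by (intro Bochner_Integration.integrable_add) (auto simp only: has_bochner_integral_iff)
  show "AE x in lborel. norm (exp (- p * x\<^sup>2 + q * \<bar>x\<bar>)) \<le> norm (exp (- p * x\<^sup>2 + q * x) + exp (- p * x\<^sup>2 + (- q) * x))"
  proof (intro AE_I2)
    fix x :: real
    have "exp (- p * x\<^sup>2 + q * \<bar>x\<bar>) = exp (- p * x\<^sup>2 + q * x) \<or> exp (- p * x\<^sup>2 + q * \<bar>x\<bar>) = exp (- p * x\<^sup>2 + (- q) * x)"
      by (simp add: abs_if)
    moreover have "exp (- p * x\<^sup>2 + q * x) > 0" "exp (- p * x\<^sup>2 + (- q) * x) > 0"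
      by (rule exp_gt_zero)+
    ultimately show "norm (exp (- p * x\<^sup>2 + q * \<bar>x\<bar>)) \<le> norm (exp (- p * x\<^sup>2 + q * x) + exp (- p * x\<^sup>2 + (- q) * x))"
      unfolding real_norm_def by linarith
  qed
qed simp

text \<open>Integration by parts with vanishing boundary terms; it yields the two moment identities
  below.\<close>

lemma integral_derivative_eq_0:
  fixes F f :: "real \<Rightarrow> complex"
  assumes "\<And>x. (F has_vector_derivative f x) (at x)" "\<And>x. isCont f x"
    and "integrable lborel f" and "(F \<longlongrightarrow> 0) at_top" "(F \<longlongrightarrow> 0) at_bot"
  shows "(LINT x|lborel. f x) = 0"
proof -
  have "(LBINT x=-\<infinity>..\<infinity>. f x) = 0 - 0"
    using assms
    by (intro interval_integral_FTC_integrable)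
      (auto simp: set_integrable_def ereal_tendsto_simps)
  then show ?thesis by (simp add: interval_lebesgue_integral_def set_lebesgue_integral_def)
qed

lemma norm_gauss: "cmod (exp (- p * (of_real x)\<^sup>2 + q * of_real x)) = exp (- Re p * x\<^sup>2 + Re q * x)"
  by (simp add: power2_eq_square)

lemma gauss_decay:
  fixes p q :: real
  assumes "p > 0"
  shows "((\<lambda>x. exp (- p * x\<^sup>2 + q * x)) \<longlongrightarrow> 0) at_top" "((\<lambda>x. exp (- p * x\<^sup>2 + q * x)) \<longlongrightarrow> 0) at_bot"
    "((\<lambda>x. \<bar>x\<bar> * exp (- p * x\<^sup>2 + q * x)) \<longlongrightarrow> 0) at_top" "((\<lambda>x. \<bar>x\<bar> * exp (- p * x\<^sup>2 + q * x)) \<longlongrightarrow> 0) at_bot"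
  using assms by real_asymp+

lemma exp_bound_power_fact: "x \<ge> 0 \<Longrightarrow> (x::real) ^ n \<le> fact n * exp x"
proof -
  assume x: "x \<ge> 0"
  have "(\<Sum>k\<in>{n}. x ^ k /\<^sub>R fact k) \<le> (\<Sum>k. x ^ k /\<^sub>R fact k)"
    by (rule sum_le_suminf[OF summable_exp_generic]) (use x in auto)
  then show ?thesis by (simp add: exp_def field_simps)
qed

text \<open>Since |x|^n \<le> n! exp |x|, a monomial only raises the linear coefficient of the real
  majorant by 1.\<close>

lemma integrable_gauss_poly:
  fixes p q :: complex
  assumes p: "Re p > 0"
  shows "integrable lborel (\<lambda>x. (of_real x)^n * exp (- p * (of_real x)\<^sup>2 + q * of_real x))"
proof (rule Bochner_Integration.integrable_bound)
  show "integrable lborel (\<lambda>x. fact n * exp (- Re p * x\<^sup>2 + (\<bar>Re q\<bar> + 1) * \<bar>x\<bar>))"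
    using integrable_gauss_abs[OF p] by (rule integrable_mult_right)
  show "AE x in lborel. norm ((of_real x)^n * exp (- p * (of_real x)\<^sup>2 + q * of_real x))
     \<le> norm (fact n * exp (- Re p * x\<^sup>2 + (\<bar>Re q\<bar> + 1) * \<bar>x\<bar>))"
  proof (intro AE_I2)
    fix x :: real
    have "\<bar>x\<bar> ^ n / fact n \<le> exp \<bar>x\<bar>"
      using exp_bound_power_fact[of "\<bar>x\<bar>" n] by (simp add: field_simps)
    moreover have "Re q * x \<le> \<bar>Re q\<bar> * \<bar>x\<bar>" by (metis abs_ge_self abs_mult)
    ultimately have "(\<bar>x\<bar> ^ n / fact n) * exp (- Re p * x\<^sup>2 + Re q * x) \<le> exp \<bar>x\<bar> * exp (- Re p * x\<^sup>2 + \<bar>Re q\<bar> * \<bar>x\<bar>)"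
      by (intro mult_mono) auto
    then show "norm ((of_real x)^n * exp (- p * (of_real x)\<^sup>2 + q * of_real x))
     \<le> norm (fact n * exp (- Re p * x\<^sup>2 + (\<bar>Re q\<bar> + 1) * \<bar>x\<bar>))"
      unfolding norm_mult norm_gauss norm_power
      by (simp add: field_simps flip: exp_add)
  qed
qed simp

text \<open>Integrates the derivative of the Gaussian itself. The identity turns the q-derivative of
  I = \<open>LINT\<close> of the Gaussian into the differential equation I' = q/(2p) I.\<close>

lemma integral_gauss_moment1:
  assumes p: "Re p > 0"
  shows "(LINT x|lborel. of_real x * exp (- p * (of_real x)\<^sup>2 + q * of_real x)) * (2 * p)
    = q * (LINT x|lborel. exp (- p * (of_real x)\<^sup>2 + q * of_real x))"
proof -
  have "(LINT x|lborel. (- (2 * p) * of_real x + q) * exp (- p * (of_real x)\<^sup>2 + q * of_real x)) = 0"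
  proof (rule integral_derivative_eq_0)
    show "((\<lambda>x. exp (- p * (of_real x)\<^sup>2 + q * of_real x)) has_vector_derivative
      (- (2 * p) * of_real x + q) * exp (- p * (of_real x)\<^sup>2 + q * of_real x)) (at x)" for x
      by (rule has_vector_derivative_real_field) (auto intro!: derivative_eq_intros)
    show "isCont (\<lambda>x. (- (2 * p) * of_real x + q) * exp (- p * (of_real x)\<^sup>2 + q * of_real x)) x" for x
      by (intro continuous_intros)
    show "integrable lborel (\<lambda>x. (- (2 * p) * of_real x + q) * exp (- p * (of_real x)\<^sup>2 + q * of_real x))"
      unfolding distrib_right mult.assoc[of "- (2 * p)"]
      using integrable_gauss_poly[OF p, of 1 q] integrable_gauss_poly[OF p, of 0 q]
      by (intro Bochner_Integration.integrable_add integrable_mult_right) (simp_all only: power_one_right power_0 mult_1)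
    show "((\<lambda>x. exp (- p * (of_real x)\<^sup>2 + q * of_real x)) \<longlongrightarrow> 0) at_top"
      "((\<lambda>x. exp (- p * (of_real x)\<^sup>2 + q * of_real x)) \<longlongrightarrow> 0) at_bot"
      using gauss_decay(1,2)[OF p, of "Re q"] by (rule_tac [!] tendsto_norm_zero_cancel) (simp_all only: norm_gauss)
  qed
  then show ?thesis
    using integrable_gauss_poly[OF p, of 1 q] integrable_gauss_poly[OF p, of 0 q]
    by (simp add: ring_distribs mult.assoc)
qed

text \<open>Integrates the derivative of x exp(-p x^2). It gives the differential equation I' =
  -I/(2p) in the variable p.\<close>

lemma integral_gauss_moment2:
  assumes p: "Re p > 0"
  shows "(LINT x|lborel. (of_real x)\<^sup>2 * exp (- p * (of_real x)\<^sup>2)) * (2 * p)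
    = (LINT x|lborel. exp (- p * (of_real x)\<^sup>2))"
proof -
  have "(LINT x|lborel. (1 - (2 * p) * (of_real x)\<^sup>2) * exp (- p * (of_real x)\<^sup>2)) = 0"
  proof (rule integral_derivative_eq_0)
    show "((\<lambda>x. of_real x * exp (- p * (of_real x)\<^sup>2)) has_vector_derivative
      (1 - (2 * p) * (of_real x)\<^sup>2) * exp (- p * (of_real x)\<^sup>2)) (at x)" for x
      by (rule has_vector_derivative_real_field)
        (auto intro!: derivative_eq_intros simp: algebra_simps power2_eq_square)
    show "isCont (\<lambda>x. (1 - (2 * p) * (of_real x)\<^sup>2) * exp (- p * (of_real x)\<^sup>2)) x" for x
      by (intro continuous_intros)
    show "integrable lborel (\<lambda>x. (1 - (2 * p) * (of_real x)\<^sup>2) * exp (- p * (of_real x)\<^sup>2))"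
      unfolding left_diff_distrib mult.assoc[of "2 * p"]
      using integrable_gauss_poly[OF p, of 2 0] integrable_gauss_poly[OF p, of 0 0]
      by (intro Bochner_Integration.integrable_diff integrable_mult_right) (simp_all only: power_0 mult_1 mult_zero_left add_0_right)
    show "((\<lambda>x. of_real x * exp (- p * (of_real x)\<^sup>2)) \<longlongrightarrow> 0) at_top"
      "((\<lambda>x. of_real x * exp (- p * (of_real x)\<^sup>2)) \<longlongrightarrow> 0) at_bot"
      using gauss_decay(3,4)[OF p, of 0] norm_gauss[of p _ 0]
      by (rule_tac [!] tendsto_norm_zero_cancel) (simp_all add: norm_mult)
  qed
  then show ?thesis
    using integrable_gauss_poly[OF p, of 2 0] integrable_gauss_poly[OF p, of 0 0]
    by (simp add: ring_distribs mult.assoc)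
qed

lemma has_field_derivative_integral_exp:
  fixes l :: "'a \<Rightarrow> complex" and k :: "'a \<Rightarrow> complex"
  assumes r: "r > 0"
    and [measurable]: "k \<in> borel_measurable M" "l \<in> borel_measurable M"
    and int: "integrable M (\<lambda>x. cmod (k x) * exp (r * cmod (l x)))"
  shows "((\<lambda>s. \<integral>x. k x * exp (s * l x) \<partial>M) has_field_derivative (\<integral>x. k x * l x \<partial>M)) (at 0)"
proof -
  have "((\<lambda>s. \<integral>x. k x * exp (s * l x) \<partial>M) has_derivative (\<lambda>s. \<integral>x. k x * (s * l x) \<partial>M)) (at 0)"
    by (rule has_derivative_integral_exp[where L="\<lambda>x. cmod (l x)" and r=r])
      (use r int in \<open>auto simp: norm_mult intro!: bounded_linear.linear bounded_linear_intros\<close>)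
  moreover have "(\<integral>x. k x * (s * l x) \<partial>M) = (\<integral>x. k x * l x \<partial>M) * s" for s
    by (simp add: mult.left_commute[of _ s] mult.commute[of _ s])
  ultimately show ?thesis by (simp add: has_field_derivative_def)
qed

lemma gauss_deriv_p:
  assumes p: "Re p > 0"
  shows "((\<lambda>p. LINT x|lborel. exp (- p * (of_real x)\<^sup>2)) has_field_derivative
     - (LINT x|lborel. exp (- p * (of_real x)\<^sup>2)) / (2 * p)) (at p)"
proof -
  have p0: "p \<noteq> 0" using p by auto
  \<comment> \<open>The increment s is differentiated at 0, written as \<open>p - p\<close> so that
    the chain rule with s = q - p moves the base point to p.\<close>
  have "((\<lambda>s. LINT x|lborel. exp (- p * (of_real x)\<^sup>2) * exp (s * (- (of_real x)\<^sup>2))) has_field_derivative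
     (LINT x|lborel. exp (- p * (of_real x)\<^sup>2) * (- (of_real x)\<^sup>2))) (at (p - p))"
    unfolding diff_self
  \<comment> \<open>Here the perturbation grows like x^2, so r must stay below \<open>Re p\<close>;
    half of it leaves the Gaussian exp(-Re p/2 * x^2).\<close>
  proof (rule has_field_derivative_integral_exp[where r = "Re p / 2"])
    have "exp (- (Re p / 2) * x\<^sup>2 + 0 * \<bar>x\<bar>) = cmod (exp (- p * (of_real x)\<^sup>2)) * exp (Re p / 2 * cmod (- (of_real x)\<^sup>2))" for x
      using norm_gauss[of p x 0] by (simp add: norm_power flip: exp_add)
    then show "integrable lborel (\<lambda>x. cmod (exp (- p * (of_real x)\<^sup>2)) * exp (Re p / 2 * cmod (- (of_real x)\<^sup>2)))"
      using integrable_gauss_abs[of "Re p / 2" 0] p by (simp only: half_gt_zero_iff simp_thms)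
  qed (use p in auto)
  from DERIV_chain2[where g = "\<lambda>s. s - p", OF this DERIV_diff[OF DERIV_ident DERIV_const]] 
  have "((\<lambda>q. LINT x|lborel. exp (- p * (of_real x)\<^sup>2) * exp ((q - p) * (- (of_real x)\<^sup>2))) has_field_derivative
     - (LINT x|lborel. (of_real x)\<^sup>2 * exp (- p * (of_real x)\<^sup>2))) (at p)"
    by (simp add: mult.commute)
  moreover have "(LINT x|lborel. (of_real x)\<^sup>2 * exp (- p * (of_real x)\<^sup>2)) = (LINT x|lborel. exp (- p * (of_real x)\<^sup>2)) / (2 * p)"
    using integral_gauss_moment2[OF p] p0 by (simp add: eq_divide_eq)
  ultimately show ?thesis by (simp flip: exp_add add: algebra_simps)
qed

lemma gauss_deriv_q:
  assumes p: "Re p > 0"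
  shows "((\<lambda>q. LINT x|lborel. exp (- p * (of_real x)\<^sup>2 + q * of_real x)) has_field_derivative
     (LINT x|lborel. exp (- p * (of_real x)\<^sup>2 + q * of_real x)) * (q / (2 * p))) (at q)"
proof -
  have p0: "p \<noteq> 0" using p by auto
  have "((\<lambda>s. LINT x|lborel. exp (- p * (of_real x)\<^sup>2 + q * of_real x) * exp (s * of_real x)) has_field_derivative
     (LINT x|lborel. exp (- p * (of_real x)\<^sup>2 + q * of_real x) * of_real x)) (at (q - q))"
    unfolding diff_self
  proof (rule has_field_derivative_integral_exp[where r = 1])
    show "integrable lborel (\<lambda>x. cmod (exp (- p * (of_real x)\<^sup>2 + q * of_real x)) * exp (1 * cmod (of_real x)))"
      unfolding norm_gauss
    proof (rule Bochner_Integration.integrable_bound[OF integrable_gauss_abs[OF p, of "\<bar>Re q\<bar> + 1"]])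
      have "Re q * x \<le> \<bar>Re q\<bar> * \<bar>x\<bar>" for x by (metis abs_ge_self abs_mult)
      then show "AE x in lborel. norm (exp (- Re p * x\<^sup>2 + Re q * x) * exp (1 * cmod (of_real x)))
          \<le> norm (exp (- Re p * x\<^sup>2 + (\<bar>Re q\<bar> + 1) * \<bar>x\<bar>))"
        by (simp flip: exp_add add: algebra_simps)
    qed simp
  qed auto
  from DERIV_chain2[where g = "\<lambda>s. s - q", OF this DERIV_diff[OF DERIV_ident DERIV_const]]
  have "((\<lambda>z. LINT x|lborel. exp (- p * (of_real x)\<^sup>2 + q * of_real x) * exp ((z - q) * of_real x)) has_field_derivative
     (LINT x|lborel. of_real x * exp (- p * (of_real x)\<^sup>2 + q * of_real x))) (at q)"
    by (simp add: mult.commute)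
  moreover have "(LINT x|lborel. of_real x * exp (- p * (of_real x)\<^sup>2 + q * of_real x))
      = (LINT x|lborel. exp (- p * (of_real x)\<^sup>2 + q * of_real x)) * (q / (2 * p))"
    using integral_gauss_moment1[OF p, of q] p0 by (simp add: eq_divide_eq mult.commute)
  ultimately show ?thesis by (simp flip: exp_add add: algebra_simps)
qed

text \<open>The product of the integral with \<open>csqrt p\<close> has zero derivative on the right
  half-plane, which is convex and avoids the branch cut. It is therefore constant, and its value at
  p = 1 is the real Gaussian integral. This is where the branch of the root is determined.\<close>

lemma integral_gauss_complex_0:
  assumes p: "Re p > 0"
  shows "(LINT x|lborel. exp (- p * (of_real x)\<^sup>2)) = of_real (sqrt pi) / csqrt p"
proof -
  define H where "H p = (LINT x|lborel. exp (- p * (of_real x)\<^sup>2))" for p :: complex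
  have d: "((\<lambda>p. H p * csqrt p) has_field_derivative 0) (at p within {p. Re p > 0})"
    if "p \<in> {p. Re p > 0}" for p
  proof -
    have p: "Re p > 0" using that by simp
    then have np: "p \<notin> \<real>\<^sub>\<le>\<^sub>0" by (auto simp: complex_nonpos_Reals_iff)
    have c0: "csqrt p \<noteq> 0" "p \<noteq> 0" using p by auto
    have pp: "p = csqrt p * csqrt p" by (metis power2_csqrt power2_eq_square)
    have "((\<lambda>p. H p * csqrt p) has_field_derivative - H p / (2 * p) * csqrt p + H p * inverse (2 * csqrt p)) (at p)"
      using DERIV_mult'[OF gauss_deriv_p[OF p, folded H_def] has_field_derivative_csqrt[OF np]]
      by (simp only: add.commute)
    moreover have "- H p / (2 * p) * csqrt p + H p * inverse (2 * csqrt p) = 0"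
    proof -
      have "- h / (2 * (s * s)) * s + h * inverse (2 * s) = 0" if "s \<noteq> 0" for h s :: complex
        using that by (simp add: field_simps)
      from this[OF c0(1)] show ?thesis unfolding pp[symmetric] .
    qed
    ultimately show ?thesis by (metis has_field_derivative_at_within)
  qed
  have "\<exists>c. \<forall>p\<in>{p. Re p > 0}. H p * csqrt p = c"
    by (rule has_field_derivative_zero_constant[OF convex_halfspace_Re_gt d])
  then obtain c where c: "\<And>p. Re p > 0 \<Longrightarrow> H p * csqrt p = c" by auto
  have "H p * csqrt p = H 1" using c[OF p] c[of 1] by simp
  also have "H 1 = of_real (LINT x|lborel. exp (- 1 * x\<^sup>2 + 0 * x))"
    unfolding H_def by (subst integral_complex_of_real[symmetric])
      (simp only: exp_of_real[symmetric] of_real_add of_real_minus of_real_mult of_real_1 of_real_power of_real_0 mult_zero_left add_0_right)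
  also have "\<dots> = of_real (sqrt pi)"
    using has_bochner_integral_gauss_real[of 1 0] by (simp add: has_bochner_integral_iff)
  finally show ?thesis using p c[of p] unfolding H_def
    by (metis csqrt_eq_0 eq_divide_eq less_irrefl zero_complex.sel(1))
qed

text \<open>The same method in q: multiplying by exp(-q^2/(4p)) makes the integral constant, and q =
  0 is the previous case. A shift of the contour is thereby avoided.\<close>

lemma integral_gauss_complex:
  assumes p: "Re p > 0"
  shows "(LINT x|lborel. exp (- p * (of_real x)\<^sup>2 + q * of_real x)) = of_real (sqrt pi) / csqrt p * exp (q\<^sup>2 / (4 * p))"
proof -
  define H where "H q = (LINT x|lborel. exp (- p * (of_real x)\<^sup>2 + q * of_real x))" for q :: complex
  have p0: "p \<noteq> 0" using p by auto
  have "((\<lambda>q. H q * exp (- (q\<^sup>2 / (4 * p)))) has_field_derivative 0) (at q within UNIV)" for q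
  proof -
    have "((\<lambda>q. exp (- (q\<^sup>2 / (4 * p)))) has_field_derivative exp (- (q\<^sup>2 / (4 * p))) * - (q / (2 * p))) (at q)"
      using p0 by (auto intro!: derivative_eq_intros simp: field_simps)
    from DERIV_mult'[OF gauss_deriv_q[OF p, of q, folded H_def] this] show ?thesis
      by (simp add: algebra_simps)
  qed
  then have "\<exists>c. \<forall>q\<in>UNIV. H q * exp (- (q\<^sup>2 / (4 * p))) = c"
    by (intro has_field_derivative_zero_constant) auto
  then obtain c where c: "\<And>q. H q * exp (- (q\<^sup>2 / (4 * p))) = c" by auto
  have "H q * exp (- (q\<^sup>2 / (4 * p))) = H 0" using c[of q] c[of 0] by simp
  then have "H q = H 0 * exp (q\<^sup>2 / (4 * p))" by (simp add: exp_minus field_simps)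
  moreover have "H 0 = of_real (sqrt pi) / csqrt p"
    using integral_gauss_complex_0[OF p] by (simp add: H_def)
  ultimately show ?thesis by (simp add: H_def)
qed

subsection \<open>Lebesgue measure on products of lines and on complex vectors\<close>


lemma Basis_real_vec: "(Basis :: (real^'n) set) = range (\<lambda>k. axis k 1)"
  by (auto simp: Basis_vec_def)

text \<open>\<open>lborel\<close> on vectors is the image of a product measure indexed by
  \<open>Basis\<close>. Reindexing along k \<mapsto> \<open>axis k 1\<close> turns the product over
  coordinates into a product over the basis, where Fubini for finite products applies.\<close>

lemma
  fixes f :: "'n::finite \<Rightarrow> real \<Rightarrow> 'b::{real_normed_field,banach,second_countable_topology}"
  assumes f: "\<And>k. integrable lborel (f k)"
  shows integrable_lborel_vec_prod: "integrable lborel (\<lambda>x::real^'n. \<Prod>k\<in>UNIV. f k (x $ k))"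
    and integral_lborel_vec_prod: "(LINT x|lborel. (\<Prod>k\<in>UNIV. f k ((x::real^'n) $ k))) = (\<Prod>k\<in>UNIV. (LINT x|lborel. f k x))"
proof -
  interpret product_sigma_finite "\<lambda>_::real^'n. lborel :: real measure" ..
  let ?a = "\<lambda>k::'n. axis k 1 :: real^'n"
  let ?S = "\<lambda>g. \<Sum>b\<in>Basis. g b *\<^sub>R b :: real^'n"
  define f' where "f' b = f (inv_into UNIV ?a b)" for b
  have inj: "inj ?a" by (auto simp: inj_on_def axis_eq_axis)
  have f': "f' (?a k) = f k" for k by (simp only: f'_def inv_into_f_f[OF inj UNIV_I])
  have nth: "?S g $ k = g (?a k)" for g k
  proof -
    have "?S g $ k = ?S g \<bullet> ?a k" by (simp add: inner_axis)
    also have "\<dots> = g (?a k)" by (rule inner_sum_left_Basis) (simp add: Basis_real_vec)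
    finally show ?thesis .
  qed
  have reindex: "(\<Prod>k\<in>UNIV. F (?a k)) = (\<Prod>b\<in>Basis. F b)" for F :: "real^'n \<Rightarrow> 'b"
    unfolding Basis_real_vec by (simp add: prod.reindex[OF inj])
  have prod: "(\<Prod>k\<in>UNIV. f k (?S g $ k)) = (\<Prod>b\<in>Basis. f' b (g b))" for g
    unfolding nth f'[symmetric] by (rule reindex)
  have [measurable]: "f k \<in> borel_measurable borel" for k using f[of k] by simp
  have S[measurable]: "?S \<in> measurable (\<Pi>\<^sub>M b\<in>Basis. lborel) borel" by simp
  have i: "integrable lborel (f' b)" for b unfolding f'_def by (rule f)
  show "integrable lborel (\<lambda>x::real^'n. \<Prod>k\<in>UNIV. f k (x $ k))"
    by (subst lborel_eq, subst integrable_distr_eq) (simp_all add: prod product_integrable_prod i del: sum_component)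
  have "(LINT x|lborel. (\<Prod>k\<in>UNIV. f k ((x::real^'n) $ k))) = (\<integral>g. (\<Prod>b\<in>Basis. f' b (g b)) \<partial>(\<Pi>\<^sub>M b\<in>Basis. lborel))"
    by (subst lborel_eq, subst integral_distr) (simp_all add: prod del: sum_component)
  also have "\<dots> = (\<Prod>b\<in>Basis. (LINT x|lborel. f' b x))"
    by (rule product_integral_prod) (simp_all add: i)
  also have "\<dots> = (\<Prod>k\<in>UNIV. (LINT x|lborel. f k x))" by (simp flip: reindex add: f')
  finally show "(LINT x|lborel. (\<Prod>k\<in>UNIV. f k ((x::real^'n) $ k))) = (\<Prod>k\<in>UNIV. (LINT x|lborel. f k x))" .
qed

lemma Complex_vec_nth [simp]: "Complex_vec u v $ k = Complex (u $ k) (v $ k)"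
  by (simp add: Complex_vec_def)

lemma continuous_on_Complex_vec: "continuous_on UNIV (\<lambda>p :: (real^'n) \<times> (real^'n). Complex_vec (fst p) (snd p))"
  unfolding Complex_vec_def by (intro continuous_intros)

lemma measurable_Complex_vec [measurable]:
  "(\<lambda>p. Complex_vec (fst p) (snd p)) \<in> borel_measurable (borel \<Otimes>\<^sub>M (borel :: (real^'n) measure))"
  unfolding borel_prod by (rule borel_measurable_continuous_onI) (rule continuous_on_Complex_vec)

lemma Basis_complex_vec: "(Basis :: (complex^'n) set) = range (\<lambda>k. axis k 1) \<union> range (\<lambda>k. axis k \<i>)"
  by (auto simp: Basis_vec_def Basis_complex_def)

lemma prod_Basis_complex_vec:
  fixes F :: "complex^'n \<Rightarrow> 'b::comm_monoid_mult"
  shows "prod F Basis = (\<Prod>k\<in>UNIV. F (axis k 1)) * (\<Prod>k\<in>UNIV. F (axis k \<i>))"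
proof -
  have "prod F (range (\<lambda>k. axis k z)) = (\<Prod>k\<in>UNIV. F (axis k z))" if "z \<noteq> 0" for z :: complex
    using that by (subst prod.reindex) (auto simp: inj_on_def axis_eq_axis)
  then show ?thesis
    unfolding Basis_complex_vec by (subst prod.union_disjoint) (auto simp: axis_eq_axis)
qed

lemma prod_Basis_real_vec:
  fixes F :: "real^'n \<Rightarrow> 'b::comm_monoid_mult"
  shows "prod F Basis = (\<Prod>k\<in>UNIV. F (axis k 1))"
  unfolding Basis_real_vec by (subst prod.reindex) (auto simp: inj_on_def axis_eq_axis)

lemma mem_box_real_vec: "x \<in> box l (u :: real^'n) \<longleftrightarrow> (\<forall>k. l $ k < x $ k \<and> x $ k < u $ k)"
  by (auto simp: mem_box Basis_real_vec inner_axis)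

lemma mem_box_complex_vec: "z \<in> box l (u :: complex^'n) \<longleftrightarrow>
    (\<forall>k. Re (l $ k) < Re (z $ k) \<and> Re (z $ k) < Re (u $ k) \<and> Im (l $ k) < Im (z $ k) \<and> Im (z $ k) < Im (u $ k))"
  unfolding mem_box Basis_complex_vec ball_Un by (auto simp: inner_axis inner_complex_def)

text \<open>Both measures agree on boxes, since a box of complex vectors is a box of real parts
  times a box of imaginary parts. This allows the Fock norm to be integrated over the imaginary part
  first.\<close>

lemma distr_lborel_Complex_vec:
  "distr (lborel \<Otimes>\<^sub>M lborel) borel (\<lambda>p. Complex_vec (fst p) (snd p)) = (lborel :: (complex^'n) measure)"
proof (rule lborel_eqI[symmetric])
  fix l u :: "complex^'n" assume le: "\<And>b. b \<in> Basis \<Longrightarrow> l \<bullet> b \<le> u \<bullet> b"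
  let ?R = "\<lambda>z::complex^'n. \<chi> k. Re (z $ k)" and ?I = "\<lambda>z::complex^'n. \<chi> k. Im (z $ k)"
  have pre: "(\<lambda>p. Complex_vec (fst p) (snd p)) -` box l u = box (?R l) (?R u) \<times> box (?I l) (?I u)"
    by (auto simp: mem_box_complex_vec mem_box_real_vec)
  have le': "Re (l $ k) \<le> Re (u $ k)" "Im (l $ k) \<le> Im (u $ k)" for k
    using le[of "axis k 1"] le[of "axis k \<i>"] by (auto simp: Basis_complex_vec inner_axis inner_complex_def)
  then have leR: "?R l \<bullet> b \<le> ?R u \<bullet> b" "?I l \<bullet> b \<le> ?I u \<bullet> b" if "b \<in> Basis" for b
    using that by (auto simp: Basis_real_vec inner_axis)
  have "emeasure (distr (lborel \<Otimes>\<^sub>M lborel) borel (\<lambda>p. Complex_vec (fst p) (snd p))) (box l u)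
    = emeasure (lborel \<Otimes>\<^sub>M lborel) (box (?R l) (?R u) \<times> box (?I l) (?I u))"
    by (subst emeasure_distr) (simp_all add: pre space_pair_measure)
  also have "\<dots> = ennreal (\<Prod>b\<in>Basis. (?R u - ?R l) \<bullet> b) * ennreal (\<Prod>b\<in>Basis. (?I u - ?I l) \<bullet> b)"
    using leR by (simp add: lborel.emeasure_pair_measure_Times)
  also have "\<dots> = ennreal (\<Prod>b\<in>Basis. (u - l) \<bullet> b)"
    using le'
    by (subst ennreal_mult[symmetric])
      (auto simp: prod_Basis_real_vec prod_Basis_complex_vec inner_axis inner_complex_def inner_diff_left intro!: prod_nonneg)
  finally show "emeasure (distr (lborel \<Otimes>\<^sub>M lborel) borel (\<lambda>p. Complex_vec (fst p) (snd p))) (box l u)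
    = ennreal (\<Prod>b\<in>Basis. (u - l) \<bullet> b)" .
qed simp

lemma nn_integral_lborel_complex_vec:
  fixes f :: "complex^'n \<Rightarrow> ennreal"
  assumes [measurable]: "f \<in> borel_measurable borel"
  shows "(\<integral>\<^sup>+z. f z \<partial>lborel) = (\<integral>\<^sup>+u. \<integral>\<^sup>+v. f (Complex_vec u v) \<partial>lborel \<partial>lborel)"
proof -
  have "(\<integral>\<^sup>+z. f z \<partial>lborel) = (\<integral>\<^sup>+p. f (Complex_vec (fst p) (snd p)) \<partial>(lborel \<Otimes>\<^sub>M lborel))"
    by (subst distr_lborel_Complex_vec[symmetric], subst nn_integral_distr) simp_all
  also have "\<dots> = (\<integral>\<^sup>+u. \<integral>\<^sup>+v. f (Complex_vec u v) \<partial>lborel \<partial>lborel)"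
    by (subst lborel.nn_integral_fst[symmetric]) simp_all
  finally show ?thesis .
qed

subsection \<open>Fourier integrals of square-integrable functions\<close>


text \<open>Everything is dominated by B |a(x)| |b(y)|. These four facts cover each interchange of
  integrals below: the kernels are characters, Gaussians, or the claimed kernel of constant
  modulus.\<close>

lemma
  fixes K :: "'a::euclidean_space \<Rightarrow> 'b::euclidean_space \<Rightarrow> complex"
  assumes K[measurable]: "case_prod K \<in> borel_measurable (borel \<Otimes>\<^sub>M borel)"
    and bound: "\<And>x y. cmod (K x y) \<le> B"
    and b: "integrable lborel b"
  shows integrable_bounded_kernel: "integrable lborel (\<lambda>y. K x y * b y)"
    and norm_integral_bounded_kernel: "cmod (LINT y|lborel. K x y * b y) \<le> B * (LINT y|lborel. cmod (b y))"
    and integrable_mult_integral_bounded_kernel: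
      "integrable lborel a \<Longrightarrow> integrable lborel (\<lambda>x. a x * (LINT y|lborel. K x y * b y))"
    and integral_swap_bounded_kernel:
      "integrable lborel a \<Longrightarrow>
        (LINT x|lborel. a x * (LINT y|lborel. K x y * b y)) = (LINT y|lborel. (LINT x|lborel. a x * K x y) * b y)"
proof -
  have [measurable]: "b \<in> borel_measurable borel" using b by simp
  have Kb: "cmod (K x y * b y) \<le> B * cmod (b y)" for x y
    using bound[of x y] by (simp add: norm_mult mult_right_mono)
  have ib: "integrable lborel (\<lambda>y. B * cmod (b y))" using b by simp
  show i: "integrable lborel (\<lambda>y. K x y * b y)" for x
    by (rule Bochner_Integration.integrable_bound[OF ib]) (auto intro!: AE_I2 order_trans[OF Kb])
  show n: "cmod (LINT y|lborel. K x y * b y) \<le> B * (LINT y|lborel. cmod (b y))" for x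
    unfolding integral_mult_right_zero[symmetric]
    using i[of x] ib Kb[of x] by (intro order_trans[OF integral_norm_bound] integral_mono) auto
  assume a: "integrable lborel a"
  then have [measurable]: "a \<in> borel_measurable borel" by simp
  show "integrable lborel (\<lambda>x. a x * (LINT y|lborel. K x y * b y))"
  proof (rule Bochner_Integration.integrable_bound)
    show "integrable lborel (\<lambda>x. cmod (a x) * (B * (LINT y|lborel. cmod (b y))))"
      using a by (intro integrable_mult_left) simp
    show "AE x in lborel. norm (a x * (LINT y|lborel. K x y * b y)) \<le> norm (cmod (a x) * (B * (LINT y|lborel. cmod (b y))))"
      using n by (intro AE_I2) (auto simp: norm_mult intro!: mult_left_mono order_trans[OF _ abs_ge_self])
  qed measurable
  have "integrable (lborel \<Otimes>\<^sub>M lborel) (\<lambda>(x, y). a x * K x y * b y)"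
  proof (rule lborel_pair.Fubini_integrable)
    have "integrable lborel (\<lambda>x. LINT y|lborel. cmod (a x * (K x y * b y)))"
    proof (rule Bochner_Integration.integrable_bound)
      show "integrable lborel (\<lambda>x. cmod (a x) * (LINT y|lborel. B * cmod (b y)))"
        using a by (intro integrable_mult_left) simp
      have "(LINT y|lborel. cmod (K x y * b y)) \<le> (LINT y|lborel. B * cmod (b y))" for x
        using i[of x] ib Kb[of x] by (intro integral_mono) auto
      then have "cmod (a x) * (LINT y|lborel. cmod (K x y * b y)) \<le> cmod (a x) * (LINT y|lborel. B * cmod (b y))" for x
        by (rule mult_left_mono) simp
      then have "(LINT y|lborel. cmod (a x * (K x y * b y))) \<le> cmod (a x) * (LINT y|lborel. B * cmod (b y))" for x
        by (simp add: norm_mult)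
      then show "AE x in lborel. norm (LINT y|lborel. cmod (a x * (K x y * b y)))
          \<le> norm (cmod (a x) * (LINT y|lborel. B * cmod (b y)))"
        unfolding real_norm_def
        by (intro AE_I2 order_trans[OF _ abs_ge_self]) (simp add: integral_nonneg_AE)
    qed measurable
    then show "integrable lborel (\<lambda>x. LINT y|lborel. norm (case (x, y) of (x, y) \<Rightarrow> a x * K x y * b y))"
      by (simp add: mult.assoc)
    show "AE x in lborel. integrable lborel (\<lambda>y. case (x, y) of (x, y) \<Rightarrow> a x * K x y * b y)"
      using i by (simp add: mult.assoc)
  qed measurable
  from lborel_pair.Fubini_integral[OF this]
  show "(LINT x|lborel. a x * (LINT y|lborel. K x y * b y)) = (LINT y|lborel. (LINT x|lborel. a x * K x y) * b y)"
    by (simp add: mult.assoc flip: integral_mult_left_zero)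
qed

lemma integral_gauss_fourier_vec:
  fixes d :: "'n::finite \<Rightarrow> real"
  assumes e: "e > 0"
  shows "integrable lborel (\<lambda>v::real^'n. exp (- of_real e * of_real (\<Sum>k\<in>UNIV. (v $ k)\<^sup>2) + \<i> * of_real (\<Sum>k\<in>UNIV. d k * v $ k)))"
    and "(LINT v|lborel. exp (- of_real e * of_real (\<Sum>k\<in>UNIV. ((v::real^'n) $ k)\<^sup>2) + \<i> * of_real (\<Sum>k\<in>UNIV. d k * v $ k)))
      = of_real (\<Prod>k\<in>UNIV. sqrt (pi / e) * exp (- (d k)\<^sup>2 / (4 * e)))"
proof -
  have eq: "exp (- of_real e * of_real (\<Sum>k\<in>UNIV. (v $ k)\<^sup>2) + \<i> * of_real (\<Sum>k\<in>UNIV. d k * v $ k))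
     = (\<Prod>k\<in>UNIV. exp (- of_real e * (of_real (v $ k))\<^sup>2 + \<i> * of_real (d k) * of_real (v $ k)))" for v :: "real^'n"
    by (simp add: exp_sum[symmetric] sum.distrib sum_distrib_left sum_negf sum_subtractf mult.assoc)
  have i: "integrable lborel (\<lambda>x. exp (- of_real e * (of_real x)\<^sup>2 + \<i> * of_real (d k) * of_real x))" for k
    using integrable_gauss_poly[of "of_real e" 0 "\<i> * of_real (d k)"] e by simp
  show "integrable lborel (\<lambda>v::real^'n. exp (- of_real e * of_real (\<Sum>k\<in>UNIV. (v $ k)\<^sup>2) + \<i> * of_real (\<Sum>k\<in>UNIV. d k * v $ k)))"
    unfolding eq using i by (rule integrable_lborel_vec_prod)
  have one: "(LINT x|lborel. exp (- of_real e * (of_real x)\<^sup>2 + \<i> * of_real (d k) * of_real x))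
      = of_real (sqrt (pi / e) * exp (- (d k)\<^sup>2 / (4 * e)))" for k
  proof -
    have d: "(\<i> * of_real (d k))\<^sup>2 / (4 * of_real e) = complex_of_real (- (d k)\<^sup>2 / (4 * e))"
      by (simp add: power_mult_distrib)
    have c: "csqrt (of_real e) = of_real (sqrt e)" using csqrt_of_real_nonneg[of "of_real e"] e by simp
    have "(LINT x|lborel. exp (- of_real e * (of_real x)\<^sup>2 + \<i> * of_real (d k) * of_real x))
        = of_real (sqrt pi) / csqrt (of_real e) * exp ((\<i> * of_real (d k))\<^sup>2 / (4 * of_real e))"
      using e by (intro integral_gauss_complex) simp
    then show ?thesis unfolding d c exp_of_real real_sqrt_divide by (simp only: of_real_mult of_real_divide)
  qed
  show "(LINT v|lborel. exp (- of_real e * of_real (\<Sum>k\<in>UNIV. ((v::real^'n) $ k)\<^sup>2) + \<i> * of_real (\<Sum>k\<in>UNIV. d k * v $ k)))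
      = of_real (\<Prod>k\<in>UNIV. sqrt (pi / e) * exp (- (d k)\<^sup>2 / (4 * e)))"
    unfolding eq by (subst integral_lborel_vec_prod) (rule i, simp only: one of_real_prod)
qed

text \<open>The mass does not depend on \<open>e\<close>, which makes the damped estimate uniform as
  \<open>e\<close> tends to 0.\<close>

lemma nn_integral_gauss_vec:
  fixes d :: "'n::finite \<Rightarrow> real" and x :: "real^'n"
  assumes e: "e > 0" and d: "\<And>k. d k \<noteq> 0"
  shows "(\<integral>\<^sup>+y. ennreal (\<Prod>k\<in>UNIV. sqrt (pi / e) * exp (- (d k * (x $ k - y $ k))\<^sup>2 / (4 * e))) \<partial>lborel)
     = ennreal (\<Prod>k\<in>UNIV. 2 * pi / \<bar>d k\<bar>)"
proof -
  have "has_bochner_integral lborel (\<lambda>y. sqrt (pi / e) * exp (- (d k * (x $ k - y))\<^sup>2 / (4 * e))) (2 * pi / \<bar>d k\<bar>)" for k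
  proof -
    let ?p = "(d k)\<^sup>2 / (4 * e)"
    have p: "?p > 0" using e d by simp
    \<comment> \<open>Expansion of the square in powers of y: \<open>?c\<close> is the term free of
      y, and it cancels against the exponent produced by the Gaussian integral.\<close>
    let ?q = "(d k)\<^sup>2 * x $ k / (2 * e)" and ?c = "- (d k)\<^sup>2 * (x $ k)\<^sup>2 / (4 * e)"
    have "has_bochner_integral lborel (\<lambda>y. (sqrt (pi / e) * exp ?c) * exp (- ?p * y\<^sup>2 + ?q * y))
       ((sqrt (pi / e) * exp ?c) * (sqrt (pi / ?p) * exp (?q\<^sup>2 / (4 * ?p))))"
      by (intro has_bochner_integral_mult_right has_bochner_integral_gauss_real p)
    moreover have "(sqrt (pi / e) * exp ?c) * exp (- ?p * y\<^sup>2 + ?q * y)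
        = sqrt (pi / e) * exp (- (d k * (x $ k - y))\<^sup>2 / (4 * e))" for y
    proof -
      have "?c + (- ?p * y\<^sup>2 + ?q * y) = - (d k * (x $ k - y))\<^sup>2 / (4 * e)"
        using e by (simp add: field_simps power2_eq_square)
      then show ?thesis by (simp only: mult.assoc exp_add[symmetric])
    qed
    moreover have "(sqrt (pi / e) * exp ?c) * (sqrt (pi / ?p) * exp (?q\<^sup>2 / (4 * ?p))) = 2 * pi / \<bar>d k\<bar>"
    proof -
      have "?c + ?q\<^sup>2 / (4 * ?p) = 0"
        using e d[of k] by (simp add: field_simps power2_eq_square)
      then have "exp ?c * exp (?q\<^sup>2 / (4 * ?p)) = 1" by (simp only: exp_add[symmetric] exp_zero)
      moreover have "sqrt (pi / e) * sqrt (pi / ?p) = sqrt ((2 * pi / d k)\<^sup>2)"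
        using e d[of k] by (subst real_sqrt_mult[symmetric]) (simp add: field_simps power2_eq_square)
      ultimately have "(sqrt (pi / e) * sqrt (pi / ?p)) * (exp ?c * exp (?q\<^sup>2 / (4 * ?p))) = 2 * pi / \<bar>d k\<bar>"
        by simp
      then show ?thesis by (simp only: mult_ac)
    qed
    ultimately show ?thesis by (simp only:)
  qed
  then have i: "integrable lborel (\<lambda>y. sqrt (pi / e) * exp (- (d k * (x $ k - y))\<^sup>2 / (4 * e)))"
    and v: "(LINT y|lborel. sqrt (pi / e) * exp (- (d k * (x $ k - y))\<^sup>2 / (4 * e))) = 2 * pi / \<bar>d k\<bar>" for k
    by (auto simp only: has_bochner_integral_iff)
  have "(\<integral>\<^sup>+y. ennreal (\<Prod>k\<in>UNIV. sqrt (pi / e) * exp (- (d k * (x $ k - y $ k))\<^sup>2 / (4 * e))) \<partial>lborel)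
    = ennreal (LINT y|lborel. (\<Prod>k\<in>UNIV. sqrt (pi / e) * exp (- (d k * (x $ k - y $ k))\<^sup>2 / (4 * e))))"
    using integrable_lborel_vec_prod[OF i] e
    by (intro nn_integral_eq_integral) (auto intro!: prod_nonneg AE_I2)
  also have "\<dots> = ennreal (\<Prod>k\<in>UNIV. 2 * pi / \<bar>d k\<bar>)"
    by (subst integral_lborel_vec_prod) (rule i, simp only: v)
  finally show ?thesis .
qed

text \<open>Schur's test for a symmetric nonnegative kernel with constant row integrals: f(x) f(y)
  is at most the mean of the two squares, and each half integrates to C/2 times the integral of f^2.
  Extended nonnegative integrals allow Tonelli without any finiteness of the right-hand
  side.\<close>

lemma nn_integral_weighted_amgm:
  fixes f :: "'a::euclidean_space \<Rightarrow> real" and G :: "'a \<Rightarrow> 'a \<Rightarrow> real"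
  assumes [measurable]: "f \<in> borel_measurable borel" "case_prod G \<in> borel_measurable (borel \<Otimes>\<^sub>M borel)"
    and G0: "\<And>x y. G x y \<ge> 0" and sym: "\<And>x y. G x y = G y x" and f0: "\<And>x. f x \<ge> 0"
    and G: "\<And>x. (\<integral>\<^sup>+y. ennreal (G x y) \<partial>lborel) = ennreal C" and C: "C \<ge> 0"
  shows "(\<integral>\<^sup>+x. \<integral>\<^sup>+y. ennreal (f x * f y * G x y) \<partial>lborel \<partial>lborel) \<le> ennreal C * (\<integral>\<^sup>+x. ennreal ((f x)\<^sup>2) \<partial>lborel)"
proof -
  let ?g = "\<lambda>x y. ennreal ((f x)\<^sup>2 / 2) * ennreal (G x y)"
  have one: "(\<integral>\<^sup>+x. \<integral>\<^sup>+y. ?g x y \<partial>lborel \<partial>lborel) = ennreal C * (\<integral>\<^sup>+x. ennreal ((f x)\<^sup>2 / 2) \<partial>lborel)"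
    by (simp add: nn_integral_cmult nn_integral_multc G mult.commute)
  have "ennreal (f x * f y * G x y) \<le> ?g x y + ?g y x" for x y
  proof -
    have "f x * f y \<le> (f x)\<^sup>2 / 2 + (f y)\<^sup>2 / 2"
      using sum_squares_bound[of "f x" "f y"] by simp
    then have "f x * f y * G x y \<le> ((f x)\<^sup>2 / 2 + (f y)\<^sup>2 / 2) * G x y"
      using G0 by (rule mult_right_mono)
    then have "f x * f y * G x y \<le> (f x)\<^sup>2 / 2 * G x y + (f y)\<^sup>2 / 2 * G y x"
      by (simp add: distrib_right sym[of y x])
    then show ?thesis
      using G0 by (simp add: ennreal_mult[symmetric] ennreal_plus[symmetric] ennreal_leI del: ennreal_plus)
  qed
  then have "(\<integral>\<^sup>+x. \<integral>\<^sup>+y. ennreal (f x * f y * G x y) \<partial>lborel \<partial>lborel)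
      \<le> (\<integral>\<^sup>+x. \<integral>\<^sup>+y. ?g x y + ?g y x \<partial>lborel \<partial>lborel)"
    by (intro nn_integral_mono)
  also have "\<dots> = (\<integral>\<^sup>+x. (\<integral>\<^sup>+y. ?g x y \<partial>lborel) + (\<integral>\<^sup>+y. ?g y x \<partial>lborel) \<partial>lborel)"
    by (intro nn_integral_cong nn_integral_add) measurable
  also have "\<dots> = (\<integral>\<^sup>+x. \<integral>\<^sup>+y. ?g x y \<partial>lborel \<partial>lborel) + (\<integral>\<^sup>+x. \<integral>\<^sup>+y. ?g y x \<partial>lborel \<partial>lborel)"
    by (intro nn_integral_add) measurable
  also have "(\<integral>\<^sup>+x. \<integral>\<^sup>+y. ?g y x \<partial>lborel \<partial>lborel) = (\<integral>\<^sup>+x. \<integral>\<^sup>+y. ?g x y \<partial>lborel \<partial>lborel)"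
    by (rule lborel_pair.Fubini') measurable
  also have "(\<integral>\<^sup>+x. \<integral>\<^sup>+y. ?g x y \<partial>lborel \<partial>lborel) + (\<integral>\<^sup>+x. \<integral>\<^sup>+y. ?g x y \<partial>lborel \<partial>lborel)
      = ennreal C * (\<integral>\<^sup>+x. ennreal ((f x)\<^sup>2 / 2) + ennreal ((f x)\<^sup>2 / 2) \<partial>lborel)"
    unfolding one by (simp add: nn_integral_add distrib_left)
  also have "\<dots> = ennreal C * (\<integral>\<^sup>+x. ennreal ((f x)\<^sup>2) \<partial>lborel)"
    by (simp add: ennreal_plus[symmetric] del: ennreal_plus)
  finally show ?thesis .
qed

text \<open>Unnormalised, with a separate frequency scale for each coordinate: constant lam for the
  Bargmann transform, -lam / sin(\<alpha> k t) for the kernel, and 1 for injectivity.\<close>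

definition fourier :: "('n::finite \<Rightarrow> real) \<Rightarrow> (real^'n \<Rightarrow> complex) \<Rightarrow> real^'n \<Rightarrow> complex" where
  "fourier d h v = (LINT x|lborel. exp (\<i> * of_real (\<Sum>k\<in>UNIV. d k * (v $ k * x $ k))) * h x)"

lemma measurable_vec_nth [measurable]: "(\<lambda>x::real^'n. x $ k) \<in> borel_measurable borel"
  by (intro borel_measurable_continuous_onI continuous_intros)

lemma borel_measurable_fourier [measurable]:
  assumes "integrable lborel h"
  shows "fourier d h \<in> borel_measurable borel"
proof -
  have [measurable]: "h \<in> borel_measurable borel" using assms by simp
  show ?thesis unfolding fourier_def[abs_def] by measurable
qed

lemma norm_fourier_le:
  assumes "integrable lborel h"
  shows "cmod (fourier d h v) \<le> (LINT x|lborel. cmod (h x))"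
proof -
  have "case_prod (\<lambda>v x. exp (\<i> * of_real (\<Sum>k\<in>UNIV. d k * (v $ k * x $ k))))
      \<in> borel_measurable (borel \<Otimes>\<^sub>M (borel :: (real^'a) measure))"
    by measurable
  from norm_integral_bounded_kernel[OF this _ assms, of 1 v] show ?thesis
    by (simp add: fourier_def)
qed

text \<open>The damping makes the v-integral absolutely convergent, so both Fourier integrals can be
  moved outside. What remains inside is the Fourier transform of a Gaussian at the frequencies d k
  (x_k - y_k), which is \<open>G\<close>.\<close>

lemma integral_damped_fourier_square:
  fixes h :: "real^'n \<Rightarrow> complex" and d :: "'n::finite \<Rightarrow> real"
  assumes e: "e > 0" and h: "integrable lborel h"
  defines "G \<equiv> \<lambda>x y. \<Prod>k\<in>UNIV. sqrt (pi / e) * exp (- (d k * (x $ k - y $ k))\<^sup>2 / (4 * e))"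
  shows "(LINT v|lborel. exp (- of_real e * of_real (\<Sum>k\<in>UNIV. (v $ k)\<^sup>2)) * cnj (fourier d h v) * fourier d h v)
    = (LINT x|lborel. (LINT y|lborel. of_real (G x y) * cnj (h y)) * h x)"
proof -
  let ?A = "\<lambda>v::real^'n. exp (- of_real e * of_real (\<Sum>k\<in>UNIV. (v $ k)\<^sup>2)) :: complex"
  let ?E = "\<lambda>v x::real^'n. exp (\<i> * of_real (\<Sum>k\<in>UNIV. d k * (v $ k * x $ k)))"
  let ?E' = "\<lambda>v x::real^'n. exp (\<i> * of_real (\<Sum>k\<in>UNIV. (- d k) * (v $ k * x $ k)))"
  have [measurable]: "h \<in> borel_measurable borel" using h by simp
  have mE: "case_prod ?E \<in> borel_measurable (borel \<Otimes>\<^sub>M borel)" "case_prod ?E' \<in> borel_measurable (borel \<Otimes>\<^sub>M borel)"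
    by measurable
  have nE: "cmod (?E v x) \<le> 1" "cmod (?E' v x) \<le> 1" for v x by (simp_all)
  have A: "integrable lborel ?A"
    using integral_gauss_fourier_vec(1)[OF e, of "\<lambda>_. 0"] by simp
  have ch: "integrable lborel (\<lambda>x. cnj (h x))" using h by simp
  have cnjF: "cnj (fourier d h v) = (LINT y|lborel. ?E' v y * cnj (h y))" for v
    unfolding fourier_def Bochner_Integration.integral_cnj[symmetric] by (simp add: exp_cnj sum_negf)
  have Acnj: "integrable lborel (\<lambda>v. ?A v * cnj (fourier d h v))"
    unfolding cnjF by (rule integrable_mult_integral_bounded_kernel[OF mE(2) nE(2) ch A])
  have AE: "integrable lborel (\<lambda>v. ?A v * ?E v x)" for x
    by (rule Bochner_Integration.integrable_bound[OF A]) (auto simp: norm_mult)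
  have step: "(LINT v|lborel. ?A v * cnj (fourier d h v) * ?E v x) = (LINT y|lborel. of_real (G x y) * cnj (h y))" for x
  proof -
    have inner: "(LINT v|lborel. (?A v * ?E v x) * ?E' v y) = of_real (G x y)" for y
    proof -
      have "(?A v * ?E v x) * ?E' v y
          = exp (- of_real e * of_real (\<Sum>k\<in>UNIV. (v $ k)\<^sup>2) + \<i> * of_real (\<Sum>k\<in>UNIV. (d k * (x $ k - y $ k)) * v $ k))" for v
        by (simp add: exp_add[symmetric] algebra_simps sum.distrib sum_negf sum_subtractf)
      then show ?thesis
        unfolding G_def using integral_gauss_fourier_vec(2)[OF e, of "\<lambda>k. d k * (x $ k - y $ k)"] by simp
    qed
    have "(LINT v|lborel. ?A v * cnj (fourier d h v) * ?E v x)
        = (LINT v|lborel. (?A v * ?E v x) * (LINT y|lborel. ?E' v y * cnj (h y)))"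
      unfolding cnjF by (simp only: mult_ac)
    also have "\<dots> = (LINT y|lborel. (LINT v|lborel. (?A v * ?E v x) * ?E' v y) * cnj (h y))"
      by (rule integral_swap_bounded_kernel[OF mE(2) nE(2) ch AE])
    also have "\<dots> = (LINT y|lborel. of_real (G x y) * cnj (h y))" by (simp only: inner)
    finally show ?thesis .
  qed
  have "(LINT v|lborel. ?A v * cnj (fourier d h v) * fourier d h v)
      = (LINT x|lborel. (LINT v|lborel. ?A v * cnj (fourier d h v) * ?E v x) * h x)"
    unfolding fourier_def[of d h] by (rule integral_swap_bounded_kernel[OF mE(1) nE(1) h Acnj[unfolded fourier_def]])
  also have "\<dots> = (LINT x|lborel. (LINT y|lborel. of_real (G x y) * cnj (h y)) * h x)"
    by (simp only: step)
  finally show ?thesis .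
qed

text \<open>By the preceding identity the damped norm is a quadratic form in \<open>h\<close> with
  kernel \<open>G\<close>. Schur's test bounds it by the mass of \<open>G\<close>, which is
  independent of \<open>e\<close>.\<close>

lemma nn_integral_damped_fourier_square_le:
  fixes h :: "real^'n \<Rightarrow> complex" and d :: "'n::finite \<Rightarrow> real"
  assumes e: "e > 0" and d: "\<And>k. d k \<noteq> 0" and h: "integrable lborel h"
  shows "(\<integral>\<^sup>+v. ennreal (exp (- e * (norm v)\<^sup>2) * (cmod (fourier d h v))\<^sup>2) \<partial>lborel)
    \<le> ennreal (\<Prod>k\<in>UNIV. 2 * pi / \<bar>d k\<bar>) * (\<integral>\<^sup>+x. ennreal ((cmod (h x))\<^sup>2) \<partial>lborel)"
proof -
  define G where "G x y = (\<Prod>k\<in>UNIV. sqrt (pi / e) * exp (- (d k * (x $ k - y $ k))\<^sup>2 / (4 * e)))" for x y :: "real^'n"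
  have [measurable]: "h \<in> borel_measurable borel" using h by simp
  have mG[measurable]: "case_prod G \<in> borel_measurable (borel \<Otimes>\<^sub>M borel)"
    unfolding G_def by measurable
  have G0: "G x y \<ge> 0" for x y using e unfolding G_def by (intro prod_nonneg) auto
  have GB: "G x y \<le> (\<Prod>k\<in>(UNIV::'n set). sqrt (pi / e))" for x y
    unfolding G_def using e by (intro prod_mono) (auto simp: mult_le_cancel_left1)
  have mG': "case_prod (\<lambda>x y. complex_of_real (G x y)) \<in> borel_measurable (borel \<Otimes>\<^sub>M borel)"
    by measurable
  have nG: "cmod (complex_of_real (G x y)) \<le> (\<Prod>k\<in>(UNIV::'n set). sqrt (pi / e))" for x y
    using G0 GB by simp
  have ch: "integrable lborel (\<lambda>x. cnj (h x))" using h by simp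
  let ?D = "\<lambda>v. exp (- of_real e * of_real (\<Sum>k\<in>UNIV. (v $ k)\<^sup>2)) * cnj (fourier d h v) * fourier d h v"
  have D: "?D v = of_real (exp (- e * (norm v)\<^sup>2) * (cmod (fourier d h v))\<^sup>2)" for v
    by (simp add: norm_vec_def L2_set_def sum_nonneg complex_norm_square exp_of_real[symmetric] mult_ac
        del: of_real_power of_real_sum)
  have iD: "integrable lborel (\<lambda>v. exp (- e * (norm v)\<^sup>2) * (cmod (fourier d h v))\<^sup>2)"
  proof (rule Bochner_Integration.integrable_bound)
    \<comment> \<open>The transform is bounded by the L1 norm of \<open>h\<close>; the majorant is
      this bound squared times the damping Gaussian, written as a Fourier integrand of frequency
      0.\<close>
    show "integrable lborel (\<lambda>v. exp (- of_real e * of_real (\<Sum>k\<in>UNIV. (v $ k)\<^sup>2) + \<i> * of_real (\<Sum>k\<in>UNIV. 0 * v $ k)) * of_real ((LINT x|lborel. cmod (h x))\<^sup>2))"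
      by (intro integrable_mult_left integral_gauss_fourier_vec(1) e)
    show "AE v in lborel. norm (exp (- e * (norm v)\<^sup>2) * (cmod (fourier d h v))\<^sup>2)
      \<le> norm (exp (- of_real e * of_real (\<Sum>k\<in>UNIV. (v $ k)\<^sup>2) + \<i> * of_real (\<Sum>k\<in>UNIV. 0 * v $ k)) * of_real ((LINT x|lborel. cmod (h x))\<^sup>2))"
      using norm_fourier_le[OF h, of d]
      by (intro AE_I2) (auto simp: norm_mult norm_vec_def L2_set_def sum_nonneg norm_power intro!: power_mono)
  qed (use h in measurable)
  have "(\<integral>\<^sup>+v. ennreal (exp (- e * (norm v)\<^sup>2) * (cmod (fourier d h v))\<^sup>2) \<partial>lborel)
      = ennreal (LINT v|lborel. exp (- e * (norm v)\<^sup>2) * (cmod (fourier d h v))\<^sup>2)"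
    by (rule nn_integral_eq_integral[OF iD]) auto
  \<comment> \<open>A nonnegative integral equals the modulus of its complex version, to which the
    double-integral identity and norm bounds apply.\<close>
  also have "(LINT v|lborel. exp (- e * (norm v)\<^sup>2) * (cmod (fourier d h v))\<^sup>2) = cmod (LINT v|lborel. ?D v)"
    by (simp only: D integral_complex_of_real norm_of_real)
      (subst abs_of_nonneg, auto intro!: integral_nonneg_AE AE_I2)
  also have "\<dots> = ennreal (cmod (LINT x|lborel. (LINT y|lborel. of_real (G x y) * cnj (h y)) * h x))"
    unfolding integral_damped_fourier_square[OF e h] G_def ..
  also have "\<dots> \<le> (\<integral>\<^sup>+x. ennreal (cmod ((LINT y|lborel. of_real (G x y) * cnj (h y)) * h x)) \<partial>lborel)"
    using integrable_mult_integral_bounded_kernel[OF mG' nG ch h]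
    by (intro integral_norm_bound_ennreal) (simp add: mult.commute)
  also have "\<dots> \<le> (\<integral>\<^sup>+x. \<integral>\<^sup>+y. ennreal (cmod (h x) * cmod (h y) * G x y) \<partial>lborel \<partial>lborel)"
  proof (rule nn_integral_mono)
    fix x
    have "ennreal (cmod (LINT y|lborel. of_real (G x y) * cnj (h y))) \<le> (\<integral>\<^sup>+y. ennreal (cmod (of_real (G x y) * cnj (h y))) \<partial>lborel)"
      by (rule integral_norm_bound_ennreal) (rule integrable_bounded_kernel[OF mG' nG ch])
    then have "ennreal (cmod (h x)) * ennreal (cmod (LINT y|lborel. of_real (G x y) * cnj (h y)))
        \<le> ennreal (cmod (h x)) * (\<integral>\<^sup>+y. ennreal (cmod (of_real (G x y) * cnj (h y))) \<partial>lborel)"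
      by (rule mult_left_mono) simp
    also have "\<dots> = (\<integral>\<^sup>+y. ennreal (cmod (h x) * cmod (h y) * G x y) \<partial>lborel)"
      using G0 by (subst nn_integral_cmult[symmetric]) (auto simp: norm_mult ennreal_mult[symmetric] mult_ac)
    finally show "ennreal (cmod ((LINT y|lborel. of_real (G x y) * cnj (h y)) * h x))
        \<le> (\<integral>\<^sup>+y. ennreal (cmod (h x) * cmod (h y) * G x y) \<partial>lborel)"
      by (simp add: norm_mult ennreal_mult mult.commute)
  qed
  also have "\<dots> \<le> ennreal (\<Prod>k\<in>UNIV. 2 * pi / \<bar>d k\<bar>) * (\<integral>\<^sup>+x. ennreal ((cmod (h x))\<^sup>2) \<partial>lborel)"
  proof (rule nn_integral_weighted_amgm)
    show "G x y = G y x" for x y unfolding G_def by (simp add: power_mult_distrib power2_commute)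
    show "(\<integral>\<^sup>+y. ennreal (G x y) \<partial>lborel) = ennreal (\<Prod>k\<in>UNIV. 2 * pi / \<bar>d k\<bar>)" for x
      unfolding G_def by (rule nn_integral_gauss_vec[OF e d])
  qed (auto simp: G0 intro!: prod_nonneg)
  finally show ?thesis .
qed

text \<open>The inequality half of Plancherel for integrable functions. With e = 1/(n+1) the damping
  factors increase to 1, so monotone convergence removes them from the uniform estimate.\<close>

lemma nn_integral_fourier_square_le:
  fixes h :: "real^'n \<Rightarrow> complex" and d :: "'n::finite \<Rightarrow> real"
  assumes d: "\<And>k. d k \<noteq> 0" and h: "integrable lborel h"
  shows "(\<integral>\<^sup>+v. ennreal ((cmod (fourier d h v))\<^sup>2) \<partial>lborel)
    \<le> ennreal (\<Prod>k\<in>UNIV. 2 * pi / \<bar>d k\<bar>) * (\<integral>\<^sup>+x. ennreal ((cmod (h x))\<^sup>2) \<partial>lborel)"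
proof -
  let ?f = "\<lambda>n v. ennreal (exp (- (1 / real (Suc n)) * (norm v)\<^sup>2) * (cmod (fourier d h v))\<^sup>2)"
  have "(\<lambda>n. \<integral>\<^sup>+v. ?f n v \<partial>lborel) \<longlonglongrightarrow> (\<integral>\<^sup>+v. ennreal ((cmod (fourier d h v))\<^sup>2) \<partial>lborel)"
  proof (rule nn_integral_LIMSEQ)
    show "incseq ?f"
      by (intro incseq_SucI le_funI ennreal_leI mult_right_mono)
        (auto simp: frac_le divide_le_eq field_simps intro!: mult_right_mono)
    show "?f n \<in> borel_measurable lborel" for n using h by measurable
    show "(\<lambda>n. ?f n v) \<longlonglongrightarrow> ennreal ((cmod (fourier d h v))\<^sup>2)" for v
    proof -
      have "(\<lambda>n. 1 / real (Suc n)) \<longlonglongrightarrow> 0" using LIMSEQ_inverse_real_of_nat by (simp add: inverse_eq_divide)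
      then have "(\<lambda>n. exp (- (1 / real (Suc n)) * (norm v)\<^sup>2) * (cmod (fourier d h v))\<^sup>2)
        \<longlonglongrightarrow> exp (- 0 * (norm v)\<^sup>2) * (cmod (fourier d h v))\<^sup>2"
        by (intro tendsto_intros)
      then show ?thesis by (intro tendsto_ennrealI) simp
    qed
  qed
  moreover have "(\<integral>\<^sup>+v. ?f n v \<partial>lborel)
      \<le> ennreal (\<Prod>k\<in>UNIV. 2 * pi / \<bar>d k\<bar>) * (\<integral>\<^sup>+x. ennreal ((cmod (h x))\<^sup>2) \<partial>lborel)" for n
    by (rule nn_integral_damped_fourier_square_le) (use d h in auto)
  ultimately show ?thesis by (intro LIMSEQ_le_const2) blast+
qed

subsection \<open>Injectivity of the Fourier transform\<close>


lemma norm_vec_power2: "(norm (x::real^'n))\<^sup>2 = (\<Sum>k\<in>UNIV. (x $ k)\<^sup>2)"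
  by (simp add: norm_vec_def L2_set_def sum_nonneg)

text \<open>A translated Gaussian is, up to a constant, the Fourier transform of a modulated one.
  Pairing the vanishing transform of \<open>h\<close> with the latter and exchanging the integrals
  gives the claim.\<close>

lemma integral_gauss_translate_eq_0:
  fixes h :: "real^'n::finite \<Rightarrow> complex"
  assumes h: "integrable lborel h" and 0: "\<And>v. fourier (\<lambda>_. 1) h v = 0" and s: "s > 0"
  shows "(LINT x|lborel. of_real (exp (- (norm (x - y))\<^sup>2 / s\<^sup>2)) * h x) = 0"
proof -
  \<comment> \<open>The transform of exp(-e |v|^2) decays like exp(-|x|^2/(4e)); this choice makes
    4e = s^2.\<close>
  define e where "e = s\<^sup>2 / 4"
  have e: "e > 0" using s by (simp add: e_def)
  let ?A = "\<lambda>v::real^'n. exp (- of_real e * of_real (\<Sum>k\<in>UNIV. (v $ k)\<^sup>2) + \<i> * of_real (\<Sum>k\<in>UNIV. (- (y $ k)) * v $ k)) :: complex"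
  let ?E = "\<lambda>v x::real^'n. exp (\<i> * of_real (\<Sum>k\<in>UNIV. 1 * (v $ k * x $ k)))"
  have mE: "case_prod ?E \<in> borel_measurable (borel \<Otimes>\<^sub>M borel)" by measurable
  have "0 = (LINT v|lborel. ?A v * fourier (\<lambda>_. 1) h v)" by (simp only: 0 mult_zero_right Bochner_Integration.integral_zero)
  also have "\<dots> = (LINT x|lborel. (LINT v|lborel. ?A v * ?E v x) * h x)"
    unfolding fourier_def
    by (rule integral_swap_bounded_kernel[OF mE _ h integral_gauss_fourier_vec(1)[OF e], where B=1]) simp
  also have "\<dots> = (LINT x|lborel. of_real (\<Prod>k\<in>(UNIV::'n set). sqrt (pi / e)) * (of_real (exp (- (norm (x - y))\<^sup>2 / s\<^sup>2)) * h x))"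
  proof -
    have "(LINT v|lborel. ?A v * ?E v x) = of_real (\<Prod>k\<in>(UNIV::'n set). sqrt (pi / e)) * of_real (exp (- (norm (x - y))\<^sup>2 / s\<^sup>2))" for x
    proof -
      have "?A v * ?E v x = exp (- of_real e * of_real (\<Sum>k\<in>UNIV. (v $ k)\<^sup>2) + \<i> * of_real (\<Sum>k\<in>UNIV. (x $ k - y $ k) * v $ k))" for v
        by (simp add: exp_add[symmetric] algebra_simps sum.distrib sum_negf sum_subtractf)
      then have "(LINT v|lborel. ?A v * ?E v x) = of_real (\<Prod>k\<in>UNIV. sqrt (pi / e) * exp (- (x $ k - y $ k)\<^sup>2 / (4 * e)))"
        by (simp only: integral_gauss_fourier_vec(2)[OF e])
      also have "(\<Prod>k\<in>UNIV. sqrt (pi / e) * exp (- (x $ k - y $ k)\<^sup>2 / (4 * e)))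
          = (\<Prod>k\<in>(UNIV::'n set). sqrt (pi / e)) * exp (- (norm (x - y))\<^sup>2 / s\<^sup>2)"
        unfolding prod.distrib exp_sum[OF finite, symmetric]
        by (simp add: e_def norm_vec_power2 sum_negf sum_divide_distrib)
      finally show ?thesis by simp
    qed
    then show ?thesis by (simp only: mult.assoc)
  qed
  also have "\<dots> = of_real (\<Prod>k\<in>(UNIV::'n set). sqrt (pi / e)) * (LINT x|lborel. of_real (exp (- (norm (x - y))\<^sup>2 / s\<^sup>2)) * h x)"
    by (rule integral_mult_right_zero)
  finally show ?thesis using e by simp
qed

lemma integrable_gauss_vec:
  assumes "e > 0"
  shows "integrable lborel (\<lambda>x::real^'n::finite. exp (- e * (norm x)\<^sup>2))"
proof -
  have "integrable lborel (\<lambda>x::real^'n. \<Prod>k\<in>UNIV. exp (- e * (x $ k)\<^sup>2 + 0 * x $ k))"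
    using has_bochner_integral_gauss_real[OF assms, of 0]
    by (intro integrable_lborel_vec_prod) (simp only: has_bochner_integral_iff)
  then show ?thesis
    by (simp add: exp_sum[symmetric] norm_vec_power2 sum_distrib_left sum_negf)
qed

lemma integral_gauss_vec_pos: "(LINT x|lborel. exp (- (norm (x::real^'n::finite))\<^sup>2)) > 0"
proof -
  have "has_bochner_integral lborel (\<lambda>x. exp (- 1 * x\<^sup>2 + 0 * x)) (sqrt (pi / 1) * exp (0\<^sup>2 / (4 * 1)))"
    by (rule has_bochner_integral_gauss_real) simp
  then have i: "integrable lborel (\<lambda>x::real. exp (- x\<^sup>2))" and v: "(LINT x|lborel. exp (- x\<^sup>2 :: real)) = sqrt pi"
    by (simp_all add: has_bochner_integral_iff)
  have "(LINT x|lborel. exp (- (norm (x::real^'n))\<^sup>2)) = (LINT x|lborel. (\<Prod>k\<in>UNIV. exp (- ((x::real^'n) $ k)\<^sup>2)))"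
    by (simp add: exp_sum[symmetric] norm_vec_power2 sum_negf)
  also have "\<dots> = (\<Prod>k\<in>(UNIV::'n set). sqrt pi)"
    by (subst integral_lborel_vec_prod) (rule i, simp only: v)
  finally show ?thesis by simp
qed

lemma integral_lborel_scale:
  fixes f :: "'a::euclidean_space \<Rightarrow> 'b::{banach, second_countable_topology}"
  assumes [measurable]: "f \<in> borel_measurable borel" and s: "s > 0"
  shows "(LINT x|lborel. f x) = s ^ DIM('a) *\<^sub>R (LINT u|lborel. f (t + s *\<^sub>R u))"
  by (subst lborel_affine[of s t]) (use s in \<open>simp_all add: integral_density integral_distr\<close>)

text \<open>\<open>F s\<close> is the unnormalised average of \<open>f\<close> over a Gaussian of
  width s. Its integral against \<open>h\<close> vanishes, because it superposes integrals of
  \<open>h\<close> against translated Gaussians. As s tends to 0 it tends pointwise to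
  \<open>f\<close> times the Gaussian mass \<open>J\<close>, which is nonzero.\<close>

lemma integral_mult_continuous_eq_0:
  fixes h :: "real^'n::finite \<Rightarrow> complex" and f :: "real^'n \<Rightarrow> complex"
  assumes h: "integrable lborel h" and 0: "\<And>v. fourier (\<lambda>_. 1) h v = 0"
    and f: "continuous_on UNIV f" "\<And>x. cmod (f x) \<le> 1" "integrable lborel f"
  shows "(LINT x|lborel. f x * h x) = 0"
proof -
  let ?g = "\<lambda>u::real^'n. complex_of_real (exp (- (norm u)\<^sup>2))"
  define F where "F s x = (LINT u|lborel. ?g u * f (x + s *\<^sub>R u))" for s x
  define J where "J = (LINT u|lborel. ?g u)"
  have [measurable]: "h \<in> borel_measurable borel" "f \<in> borel_measurable borel" using h f(3) by simp_all
  have ig: "integrable lborel ?g" using integrable_gauss_vec[of 1] by (intro integrable_of_real) simp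
  have J: "J \<noteq> 0" using integral_gauss_vec_pos[where 'n='n] by (simp add: J_def)
  have F_zero: "(LINT x|lborel. F s x * h x) = 0" if s: "s > 0" for s
  proof -
    let ?K = "\<lambda>y x::real^'n. complex_of_real (exp (- (norm (x - y))\<^sup>2 / s\<^sup>2))"
    have mK: "case_prod ?K \<in> borel_measurable (borel \<Otimes>\<^sub>M borel)" by measurable
    \<comment> \<open>The substitution y = x + s u passes between the fixed Gaussian, suited to
      dominated convergence, and the narrow one, suited to Fubini.\<close>
    have F: "of_real (s ^ DIM(real^'n)) * F s x = (LINT y|lborel. f y * ?K y x)" for x
    proof -
      have "(LINT y|lborel. f y * ?K y x) = s ^ DIM(real^'n) *\<^sub>R (LINT u|lborel. f (x + s *\<^sub>R u) * ?K (x + s *\<^sub>R u) x)"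
        by (rule integral_lborel_scale[OF _ s]) measurable
      moreover have "?K (x + s *\<^sub>R u) x = ?g u" for u
        using s by (simp add: power_mult_distrib)
      ultimately show ?thesis by (simp only: F_def scaleR_conv_of_real mult.commute)
    qed
    have "of_real (s ^ DIM(real^'n)) * (LINT x|lborel. F s x * h x) = (LINT x|lborel. (LINT y|lborel. f y * ?K y x) * h x)"
      by (simp only: F[symmetric] mult.assoc integral_mult_right_zero)
    also have "\<dots> = (LINT y|lborel. f y * (LINT x|lborel. ?K y x * h x))"
      by (rule integral_swap_bounded_kernel[OF mK _ h f(3), where B=1, symmetric]) simp
    also have "\<dots> = 0" by (simp only: integral_gauss_translate_eq_0[OF h 0 s] mult_zero_right Bochner_Integration.integral_zero)
    finally show ?thesis using s by simp
  qed
  let ?s = "\<lambda>n. 1 / real (Suc n)"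
  have s0: "?s \<longlonglongrightarrow> 0" using LIMSEQ_inverse_real_of_nat by (simp add: inverse_eq_divide)
  have nF: "cmod (?g u * f (x + s *\<^sub>R u)) \<le> exp (- (norm u)\<^sup>2)" for s u x
    using f(2)[of "x + s *\<^sub>R u"] by (simp add: norm_mult mult_le_cancel_left1)
  have F_lim: "(\<lambda>n. F (?s n) x) \<longlonglongrightarrow> f x * J" for x
  proof -
    have "(\<lambda>n. F (?s n) x) \<longlonglongrightarrow> (LINT u|lborel. ?g u * f x)"
      unfolding F_def
    proof (rule integral_dominated_convergence[where w="\<lambda>u. exp (- (norm u)\<^sup>2)"])
      show "integrable lborel (\<lambda>u::real^'n. exp (- (norm u)\<^sup>2))" using integrable_gauss_vec[of 1] by simp
      show "AE u in lborel. (\<lambda>n. ?g u * f (x + ?s n *\<^sub>R u)) \<longlonglongrightarrow> ?g u * f x"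
      proof (intro AE_I2 tendsto_mult tendsto_const)
        fix u
        have "(\<lambda>n. x + ?s n *\<^sub>R u) \<longlonglongrightarrow> x + 0 *\<^sub>R u" by (intro tendsto_intros s0)
        moreover have "isCont f x" using f(1) by (simp add: continuous_on_eq_continuous_at)
        ultimately show "(\<lambda>n. f (x + ?s n *\<^sub>R u)) \<longlonglongrightarrow> f x" by (intro isCont_tendsto_compose[of x f]) simp_all
      qed
    qed (use nF in auto)
    then show ?thesis by (simp add: J_def mult.commute)
  qed
  have "(\<lambda>n. LINT x|lborel. F (?s n) x * h x) \<longlonglongrightarrow> (LINT x|lborel. f x * J * h x)"
  proof (rule integral_dominated_convergence[where w="\<lambda>x. (LINT u|lborel. exp (- (norm (u::real^'n))\<^sup>2)) * cmod (h x)"])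
    show "(\<lambda>x. F (?s n) x * h x) \<in> borel_measurable lborel" for n unfolding F_def by measurable
    show "integrable lborel (\<lambda>x. (LINT u|lborel. exp (- (norm (u::real^'n))\<^sup>2)) * cmod (h x))" using h by simp
    show "AE x in lborel. (\<lambda>n. F (?s n) x * h x) \<longlonglongrightarrow> f x * J * h x" by (intro AE_I2 tendsto_mult F_lim tendsto_const)
    have "cmod (F s x) \<le> (LINT u|lborel. exp (- (norm (u::real^'n))\<^sup>2))" for s x
      unfolding F_def
    proof (intro order_trans[OF integral_norm_bound] integral_mono nF)
      show "integrable lborel (\<lambda>u::real^'n. exp (- (norm u)\<^sup>2))" using integrable_gauss_vec[of 1] by simp
      show "integrable lborel (\<lambda>u. cmod (?g u * f (x + s *\<^sub>R u)))"
        by (rule Bochner_Integration.integrable_bound[OF ig]) (use nF in auto)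
    qed
    then show "AE x in lborel. norm (F (?s n) x * h x) \<le> (LINT u|lborel. exp (- (norm (u::real^'n))\<^sup>2)) * cmod (h x)" for n
      by (intro AE_I2) (auto simp: norm_mult intro!: mult_right_mono)
  qed measurable
  then have "(\<lambda>n. 0) \<longlonglongrightarrow> (LINT x|lborel. f x * J * h x)" by (simp only: F_zero zero_less_divide_1_iff of_nat_0_less_iff zero_less_Suc)
  then have "(LINT x|lborel. f x * J * h x) = 0" by (simp add: LIMSEQ_const_iff)
  moreover have "(LINT x|lborel. f x * J * h x) = J * (LINT x|lborel. f x * h x)"
    unfolding integral_mult_right_zero[symmetric] by (simp only: mult_ac)
  ultimately show ?thesis using J by simp
qed

lemma integral_bounded_open_eq_0:
  fixes h :: "real^'n::finite \<Rightarrow> complex"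
  assumes h: "integrable lborel h" and 0: "\<And>v. fourier (\<lambda>_. 1) h v = 0"
    and U: "open U" "bounded U"
  shows "(LINT x|lborel. indicator U x * h x) = 0"
proof -
  \<comment> \<open>\<open>infdist\<close> to the empty set is 0 by convention, so the cut-off below
    works only if the complement is nonempty.\<close>
  have ne: "- U \<noteq> {}" using U(2) by (metis Compl_UNIV_eq bounded_subset double_compl not_bounded_UNIV)
  \<comment> \<open>Continuous functions vanishing off \<open>U\<close> and tending to its
    indicator; boundedness of \<open>U\<close> makes them integrable.\<close>
  define f where "f n x = min 1 (real n * infdist x (- U))" for n x
  have f01: "f n x \<ge> 0" "f n x \<le> 1" for n x by (auto simp: f_def infdist_nonneg)
  have f0: "f n x = 0" if "x \<notin> U" for n x using that by (simp add: f_def)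
  have cf: "continuous_on UNIV (f n)" for n unfolding f_def by (intro continuous_intros)
  have [measurable]: "f n \<in> borel_measurable borel" for n using cf by (rule borel_measurable_continuous_onI)
  have [measurable]: "U \<in> sets borel" "h \<in> borel_measurable borel" using U h by auto
  have fi: "integrable lborel (\<lambda>x. complex_of_real (f n x))" for n
  proof (rule Bochner_Integration.integrable_bound)
    show "integrable lborel (indicator U :: _ \<Rightarrow> real)"
      using U emeasure_bounded_finite[OF U(2)] by (simp add: integrable_indicator_iff infinity_ennreal_def)
    show "AE x in lborel. norm (complex_of_real (f n x)) \<le> norm (indicator U x :: real)"
      using f01 f0 by (intro AE_I2) (auto split: split_indicator)
  qed simp
  have z: "(LINT x|lborel. complex_of_real (f n x) * h x) = 0" for n
    using f01 by (intro integral_mult_continuous_eq_0 h 0 fi continuous_intros cf) auto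
  have "(\<lambda>n. LINT x|lborel. complex_of_real (f n x) * h x) \<longlonglongrightarrow> (LINT x|lborel. indicator U x * h x)"
  proof (rule integral_dominated_convergence[where w="\<lambda>x. cmod (h x)"])
    show "AE x in lborel. (\<lambda>n. complex_of_real (f n x) * h x) \<longlonglongrightarrow> indicator U x * h x"
    proof (intro AE_I2 tendsto_mult tendsto_const)
      fix x
      show "(\<lambda>n. complex_of_real (f n x)) \<longlonglongrightarrow> indicator U x"
      proof (cases "x \<in> U")
        case True
        then have "infdist x (- U) > 0"
          using in_closed_iff_infdist_zero[OF closed_Compl[OF U(1)] ne, of x] infdist_nonneg[of x "- U"] by auto
        then obtain N where N: "real N * infdist x (- U) > 1" using reals_Archimedean3 by blast
        have "f n x = 1" if "n \<ge> N" for n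
        proof -
          have "real N * infdist x (- U) \<le> real n * infdist x (- U)" using that by (intro mult_right_mono infdist_nonneg) simp
          then show ?thesis using N by (simp add: f_def)
        qed
        then have "\<forall>\<^sub>F n in sequentially. complex_of_real (f n x) = indicator U x"
          using True by (auto simp: eventually_sequentially)
        then show ?thesis by (rule tendsto_eventually)
      qed (simp add: f0)
    qed
    show "AE x in lborel. norm (complex_of_real (f n x) * h x) \<le> cmod (h x)" for n
      using f01 by (intro AE_I2) (auto simp: norm_mult intro!: mult_left_le_one_le)
  qed (use h in auto)
  then show ?thesis unfolding z by (simp add: LIMSEQ_const_iff)
qed

text \<open>A function whose integral over every Borel set vanishes is 0 almost everywhere. The
  bounded open sets form an intersection-stable generator, so Dynkin's theorem extends the preceding
  lemma from them to all Borel sets.\<close>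

lemma fourier_eq_0_imp_AE_eq_0:
  fixes h :: "real^'n::finite \<Rightarrow> complex"
  assumes h: "integrable lborel h" and 0: "\<And>v. fourier (\<lambda>_. 1) h v = 0"
  shows "AE x in lborel. h x = 0"
proof (rule sigma_finite_measure.density_zero[OF lborel.sigma_finite_measure_axioms h])
  have set0: "(LINT x|lborel. indicator A x *\<^sub>R h x) = 0" if "A \<in> sets borel" for A
  proof -
    let ?G = "{U :: (real^'n) set. open U \<and> bounded U}"
    have "A \<in> sigma_sets UNIV (range (\<lambda>(a, b). box a b))"
      using that unfolding borel_eq_box by simp
    also have "\<dots> \<subseteq> sigma_sets UNIV ?G" by (rule sigma_sets_subseteq) auto
    finally have A: "A \<in> sigma_sets UNIV ?G" .
    have G: "sigma_sets UNIV ?G \<subseteq> sets borel"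
      by (rule sets.sigma_sets_subset[of _ borel, simplified]) auto
    have "Int_stable ?G" by (auto simp: Int_stable_def)
    moreover have "?G \<subseteq> Pow UNIV" by simp
    moreover note A
    ultimately show ?thesis
    proof (induction rule: sigma_sets_induct_disjoint)
      case (basic A)
      then show ?case using integral_bounded_open_eq_0[OF h 0, of A] by (simp add: scaleR_conv_of_real of_real_indicator)
    next
      case empty then show ?case by simp
    next
      case (compl A)
      then have [measurable]: "A \<in> sets borel" using G by auto
      have "integrable lborel (\<lambda>x. indicator A x *\<^sub>R h x)" using h by (intro integrable_mult_indicator) auto
      \<comment> \<open>Complements need the integral over the whole space, which is the transform
        at frequency 0.\<close>
      moreover have "(LINT x|lborel. h x) = 0" using 0[of 0] by (simp add: fourier_def)
      moreover have "indicator (UNIV - A) x *\<^sub>R h x = h x - indicator A x *\<^sub>R h x" for x by (simp split: split_indicator)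
      ultimately show ?case using compl h by simp
    next
      case (union A)
      then have [measurable]: "A i \<in> sets borel" for i using G by auto
      have "(LINT x:(\<Union>i. A i)|lborel. h x) = (\<Sum>i. (LINT x:(A i)|lborel. h x))"
        using union h by (intro lebesgue_integral_countable_add)
          (auto simp: disjoint_family_on_def set_integrable_def intro!: integrable_mult_indicator)
      then show ?case using union by (simp add: set_lebesgue_integral_def)
    qed
  qed
  show "\<And>A. A \<in> sets lborel \<Longrightarrow> set_lebesgue_integral lborel A h = 0"
    using set0 by (simp add: set_lebesgue_integral_def)
qed

subsection \<open>Holomorphy of the Bargmann transform\<close>


lemma bilin_of_real_vec_bound: "cmod (bilin z (of_real_vec x)) \<le> norm z * norm x"
proof -
  have "cmod (bilin z (of_real_vec x)) \<le> (\<Sum>k\<in>UNIV. \<bar>cmod (z $ k)\<bar> * \<bar>x $ k\<bar>)"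
    unfolding bilin_def of_real_vec_def by (rule order_trans[OF norm_sum]) (simp add: norm_mult)
  also have "\<dots> \<le> L2_set (\<lambda>k. cmod (z $ k)) UNIV * L2_set (\<lambda>k. x $ k) UNIV" by (rule L2_set_mult_ineq)
  finally show ?thesis by (simp add: norm_vec_def L2_set_def)
qed

lemma bilin_scale_left: "bilin (c *s v) w = c * bilin v w"
  by (simp add: bilin_def sum_distrib_left mult.assoc)

lemma bilin_scaleR_left: "bilin (r *\<^sub>R v) w = r *\<^sub>R bilin v w"
  by (simp add: bilin_def scaleR_sum_right)

lemma measurable_bilin_of_real_vec [measurable]: "(\<lambda>x. bilin z (of_real_vec x)) \<in> borel_measurable borel"
  unfolding bilin_def of_real_vec_def by (intro borel_measurable_continuous_onI continuous_intros)

lemma quadratic_exponent_bound: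
  fixes lam r s :: real
  assumes "lam > 0"
  shows "lam * r * s - lam / 2 * s\<^sup>2 \<le> lam / 2 * r\<^sup>2"
proof -
  have "0 \<le> lam / 2 * (r - s)\<^sup>2" using assms by simp
  then show ?thesis by (simp add: power2_eq_square algebra_simps)
qed

text \<open>The integral left after removing the constant and the factor exp(-lam/4 z^2). Its
  exponent depends on z only linearly, as \<open>has_derivative_integral_exp\<close>
  requires.\<close>

definition bargmann_core :: "real \<Rightarrow> (real^'n \<Rightarrow> complex) \<Rightarrow> complex^'n \<Rightarrow> complex" where
  "bargmann_core lam \<phi> z = (LINT x|lborel.
     exp (of_real lam * bilin z (of_real_vec x) - of_real (lam / 2 * (x \<bullet> x))) * \<phi> x)"

lemma bargmann_eq_core:
  fixes \<phi> :: "real^'n::finite \<Rightarrow> complex"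
  shows "bargmann lam \<phi> z = of_real ((lam / pi) powr (real CARD('n) / 4)) *
     (exp (- of_real (lam / 4) * bilin z z) * bargmann_core lam \<phi> z)"
proof -
  have "exp (- of_real (lam / 4) * bilin z z + of_real lam * bilin z (of_real_vec x) - of_real (lam / 2 * (x \<bullet> x)))
     = exp (- of_real (lam / 4) * bilin z z) * exp (of_real lam * bilin z (of_real_vec x) - of_real (lam / 2 * (x \<bullet> x)))" for x
    by (simp only: exp_add[symmetric] add_diff_eq)
  then show ?thesis
    unfolding bargmann_def bargmann_core_def by (simp only: mult.assoc integral_mult_right_zero)
qed

text \<open>The extra factor exp(lam |x|) is the growth demanded for differentiation with r = 1. It
  amounts to replacing |z| by |z| + 1, and completing the square then bounds the product uniformly
  in x. Integrability of \<phi> is therefore sufficient.\<close>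

lemma norm_bargmann_kernel_le:
  fixes x :: "real^'n::finite"
  assumes "lam > 0"
  shows "cmod (exp (of_real lam * bilin z (of_real_vec x) - of_real (lam / 2 * (x \<bullet> x)))) * exp (1 * (lam * norm x))
     \<le> exp (lam / 2 * (norm z + 1)\<^sup>2)"
proof -
  have "Re (bilin z (of_real_vec x)) \<le> norm z * norm x"
    using bilin_of_real_vec_bound[of z x] complex_Re_le_cmod[of "bilin z (of_real_vec x)"] by linarith
  then have "lam * Re (bilin z (of_real_vec x)) - lam / 2 * (norm x)\<^sup>2 + lam * norm x
      \<le> lam * (norm z * norm x) - lam / 2 * (norm x)\<^sup>2 + lam * norm x"
    using assms by simp
  also have "\<dots> = lam * (norm z + 1) * norm x - lam / 2 * (norm x)\<^sup>2" by (simp add: algebra_simps)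
  also have "\<dots> \<le> lam / 2 * (norm z + 1)\<^sup>2" by (rule quadratic_exponent_bound[OF assms])
  finally show ?thesis
    by (simp add: exp_add[symmetric] dot_square_norm)
qed

lemma has_derivative_bargmann_core:
  fixes \<phi> :: "real^'n::finite \<Rightarrow> complex"
  assumes lam: "lam > 0" and \<phi>: "integrable lborel \<phi>"
  defines "k \<equiv> \<lambda>z x. exp (of_real lam * bilin z (of_real_vec x) - of_real (lam / 2 * (x \<bullet> x))) * \<phi> x"
  shows "(bargmann_core lam \<phi> has_derivative
     (\<lambda>v. LINT x|lborel. k z x * (of_real lam * bilin v (of_real_vec x)))) (at z)"
proof -
  have [measurable]: "\<phi> \<in> borel_measurable borel" using \<phi> by simp
  have [measurable]: "k z \<in> borel_measurable borel" unfolding k_def by measurable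
  have "((\<lambda>v. LINT x|lborel. k z x * exp (of_real lam * bilin v (of_real_vec x))) has_derivative
     (\<lambda>v. LINT x|lborel. k z x * (of_real lam * bilin v (of_real_vec x)))) (at 0)"
  proof (rule has_derivative_integral_exp[where L="\<lambda>x. lam * norm x" and r=1])
    show "linear (\<lambda>v. of_real lam * bilin v (of_real_vec x))" for x :: "real^'n"
      by (rule linearI) (simp_all add: bilin_add_left bilin_scaleR_left algebra_simps)
    show "cmod (of_real lam * bilin v (of_real_vec x)) \<le> norm v * (lam * norm x)" for v and x :: "real^'n"
      using mult_left_mono[OF bilin_of_real_vec_bound[of v x], of lam] lam by (simp add: norm_mult mult_ac)
    show "integrable lborel (\<lambda>x. cmod (k z x) * exp (1 * (lam * norm x)))"
    proof (rule Bochner_Integration.integrable_bound)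
      show "integrable lborel (\<lambda>x. exp (lam / 2 * (norm z + 1)\<^sup>2) * cmod (\<phi> x))" using \<phi> by simp
      show "AE x in lborel. norm (cmod (k z x) * exp (1 * (lam * norm x))) \<le> norm (exp (lam / 2 * (norm z + 1)\<^sup>2) * cmod (\<phi> x))"
      proof (intro AE_I2)
        fix x
        show "norm (cmod (k z x) * exp (1 * (lam * norm x))) \<le> norm (exp (lam / 2 * (norm z + 1)\<^sup>2) * cmod (\<phi> x))"
          using mult_right_mono[OF norm_bargmann_kernel_le[OF lam, of z x] norm_ge_zero[of "\<phi> x"]]
          unfolding k_def by (simp only: norm_mult real_norm_def abs_mult abs_exp_cancel abs_norm_cancel mult_ac)
      qed
    qed measurable
  qed (use lam in auto)
  then have "((\<lambda>v. LINT x|lborel. k z x * exp (of_real lam * bilin v (of_real_vec x))) has_derivative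
     (\<lambda>v. LINT x|lborel. k z x * (of_real lam * bilin v (of_real_vec x)))) (at (z - z))" by simp
  from has_derivative_compose[where f="\<lambda>w. w - z" and f'="\<lambda>v. v", OF _ this]
  have "((\<lambda>w. LINT x|lborel. k z x * exp (of_real lam * bilin (w - z) (of_real_vec x))) has_derivative
     (\<lambda>v. LINT x|lborel. k z x * (of_real lam * bilin v (of_real_vec x)))) (at z)"
    by (simp add: has_derivative_diff[OF has_derivative_ident has_derivative_const, simplified])
  \<comment> \<open>Linearity of the exponent in z: passing from z to w multiplies the integrand by
    the exponential of the increment.\<close>
  moreover have "(\<lambda>w. LINT x|lborel. k z x * exp (of_real lam * bilin (w - z) (of_real_vec x))) = bargmann_core lam \<phi>"
  proof
    fix w
    have "k z x * exp (of_real lam * bilin (w - z) (of_real_vec x)) =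
      exp (of_real lam * bilin w (of_real_vec x) - of_real (lam / 2 * (x \<bullet> x))) * \<phi> x" for x
    proof -
      have "bilin w (of_real_vec x) = bilin z (of_real_vec x) + bilin (w - z) (of_real_vec x)"
        by (simp add: bilin_add_left[symmetric])
      then show ?thesis by (simp add: k_def exp_add exp_diff algebra_simps)
    qed
    then show "(LINT x|lborel. k z x * exp (of_real lam * bilin (w - z) (of_real_vec x))) = bargmann_core lam \<phi> w"
      by (simp add: bargmann_core_def)
  qed
  ultimately show ?thesis by simp
qed

text \<open>\<open>has_derivative\<close> only provides real-linearity, so homogeneity under complex
  scalars is read off from the explicit derivative given by the product rule.\<close>

lemma entire_bargmann:
  fixes \<phi> :: "real^'n::finite \<Rightarrow> complex"
  assumes lam: "lam > 0" and \<phi>: "integrable lborel \<phi>"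
  shows "entire_on_Cn (bargmann lam \<phi>)"
  unfolding entire_on_Cn_def
proof
  fix z :: "complex^'n"
  define C where "C = complex_of_real ((lam / pi) powr (real CARD('n) / 4))"
  define e where "e z = exp (- of_real (lam / 4) * bilin z z)" for z :: "complex^'n"
  define e' where "e' v = e z * (- of_real (lam / 4) * (bilin z v + bilin v z))" for v
  define c' where "c' v = (LINT x|lborel. exp (of_real lam * bilin z (of_real_vec x) - of_real (lam / 2 * (x \<bullet> x))) * \<phi> x * (of_real lam * bilin v (of_real_vec x)))" for v
  have "((\<lambda>z::complex^'n. bilin z z) has_derivative (\<lambda>v. bilin z v + bilin v z)) (at z)"
    unfolding bilin_def sum.distrib[symmetric]
    by (intro has_derivative_sum has_derivative_mult bounded_linear.has_derivative[OF bounded_linear_vec_nth] has_derivative_ident)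
  from has_derivative_compose[OF has_derivative_mult_right[OF this, of "- of_real (lam / 4)"] DERIV_exp[unfolded has_field_derivative_def]]
  have "(e has_derivative e') (at z)"
    unfolding e_def[abs_def] e'_def[abs_def] .
  then have "((\<lambda>z. C * (e z * bargmann_core lam \<phi> z)) has_derivative
      (\<lambda>v. C * (e z * c' v + e' v * bargmann_core lam \<phi> z))) (at z)"
    unfolding c'_def[abs_def]
    by (intro has_derivative_mult_right has_derivative_mult has_derivative_bargmann_core lam \<phi>)
  moreover have "bargmann lam \<phi> = (\<lambda>z. C * (e z * bargmann_core lam \<phi> z))"
    unfolding C_def e_def by (rule ext) (rule bargmann_eq_core)
  moreover have "c' (c *s v) = c * c' v" for c v
    unfolding c'_def bilin_scale_left integral_mult_right_zero[symmetric] by (simp only: mult_ac)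
  moreover have "e' (c *s v) = c * e' v" for c v
  proof -
    have "bilin z (c *s v) = c * bilin z v" by (simp add: bilin_def sum_distrib_left mult_ac)
    then show ?thesis by (simp add: e'_def bilin_scale_left algebra_simps)
  qed
  ultimately show "\<exists>f'. (bargmann lam \<phi> has_derivative f') (at z) \<and> (\<forall>c v. f' (c *s v) = c * f' v)"
    by (intro exI[of _ "\<lambda>v. C * (e z * c' v + e' v * bargmann_core lam \<phi> z)"])
      (simp add: algebra_simps)
qed

subsection \<open>The Bargmann transform as a Fourier transform\<close>


lemma bilin_Complex_vec_of_real_vec:
  "bilin (Complex_vec u v) (of_real_vec x) = of_real (u \<bullet> x) + \<i> * of_real (v \<bullet> x)"
  unfolding bilin_def of_real_vec_def inner_vec_def
  by (simp add: Complex_eq algebra_simps sum.distrib sum_distrib_left)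

lemma bilin_Complex_vec_self:
  "bilin (Complex_vec u v) (Complex_vec u v) = of_real (u \<bullet> u - v \<bullet> v) + \<i> * of_real (2 * (u \<bullet> v))"
  unfolding bilin_def inner_vec_def
  by (simp add: complex_eq_iff sum_subtractf sum_distrib_left mult_ac)

lemma norm_Complex_vec: "(norm (Complex_vec u v))\<^sup>2 = u \<bullet> u + v \<bullet> v"
proof -
  have "(norm (Complex_vec u v))\<^sup>2 = (\<Sum>k\<in>UNIV. (cmod (Complex (u $ k) (v $ k)))\<^sup>2)"
    by (simp add: norm_vec_def L2_set_def sum_nonneg)
  then show ?thesis by (simp only: cmod_power2) (simp add: inner_vec_def power2_eq_square sum.distrib)
qed

lemma norm_diff_square: "(norm (x - u :: real^'n))\<^sup>2 = x \<bullet> x - 2 * (u \<bullet> x) + u \<bullet> u"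
  by (simp add: power2_norm_eq_inner inner_diff inner_commute)

text \<open>Completing the square in the real part of z: for fixed u the transform is, up to an
  explicit factor, a Fourier transform in v of \<phi> windowed by a Gaussian centred at u.\<close>

lemma bargmann_eq_fourier:
  fixes \<phi> :: "real^'n::finite \<Rightarrow> complex"
  shows "bargmann lam \<phi> (Complex_vec u v) = of_real ((lam / pi) powr (real CARD('n) / 4))
     * (exp (- of_real (lam / 4) * bilin (Complex_vec u v) (Complex_vec u v) + of_real (lam / 2 * (u \<bullet> u)))
     * fourier (\<lambda>_. lam) (\<lambda>x. of_real (exp (- lam / 2 * (norm (x - u))\<^sup>2)) * \<phi> x) v)"
proof -
  let ?z = "Complex_vec u v"
  have "exp (- of_real (lam / 4) * bilin ?z ?z + of_real lam * bilin ?z (of_real_vec x) - of_real (lam / 2 * (x \<bullet> x))) * \<phi> x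
    = exp (- of_real (lam / 4) * bilin ?z ?z + of_real (lam / 2 * (u \<bullet> u)))
      * (exp (\<i> * of_real (\<Sum>k\<in>UNIV. lam * (v $ k * x $ k))) * (of_real (exp (- lam / 2 * (norm (x - u))\<^sup>2)) * \<phi> x))" for x
  proof -
    have s: "(\<Sum>k\<in>UNIV. lam * (v $ k * x $ k)) = lam * (v \<bullet> x)"
      by (simp add: inner_vec_def sum_distrib_left)
    have "- of_real (lam / 4) * bilin ?z ?z + of_real lam * bilin ?z (of_real_vec x) - of_real (lam / 2 * (x \<bullet> x))
      = (- of_real (lam / 4) * bilin ?z ?z + of_real (lam / 2 * (u \<bullet> u))) + (\<i> * of_real (lam * (v \<bullet> x))
        + of_real (- lam / 2 * (norm (x - u))\<^sup>2))"
      unfolding bilin_Complex_vec_of_real_vec norm_diff_square by (simp add: field_simps)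
    then show ?thesis unfolding s exp_of_real[symmetric] by (simp only: exp_add mult.assoc)
  qed
  then show ?thesis
    unfolding bargmann_def fourier_def by (simp only: integral_mult_right_zero)
qed

text \<open>The explicit factor has modulus exp(lam/4 |z|^2), which the Fock weight cancels
  exactly.\<close>

lemma norm_bargmann_Complex_vec:
  fixes \<phi> :: "real^'n::finite \<Rightarrow> complex"
  shows "(cmod (bargmann lam \<phi> (Complex_vec u v)))\<^sup>2 * exp (- (lam * (norm (Complex_vec u v))\<^sup>2 / 2))
     = ((lam / pi) powr (real CARD('n) / 4))\<^sup>2 *
       (cmod (fourier (\<lambda>_. lam) (\<lambda>x. of_real (exp (- lam / 2 * (norm (x - u))\<^sup>2)) * \<phi> x) v))\<^sup>2"
proof -
  let ?P = "exp (- of_real (lam / 4) * bilin (Complex_vec u v) (Complex_vec u v) + of_real (lam / 2 * (u \<bullet> u)))"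
  have "(cmod ?P)\<^sup>2 * exp (- (lam * (norm (Complex_vec u v))\<^sup>2 / 2)) = 1"
    unfolding norm_exp_eq_Re bilin_Complex_vec_self norm_Complex_vec power2_eq_square[of "exp _"] exp_add[symmetric]
    by (simp add: field_simps)
  then show ?thesis
    unfolding bargmann_eq_fourier norm_mult power_mult_distrib norm_of_real by simp
qed

lemma L2_fun_measurable [measurable_dest]: "\<phi> \<in> L2_fun \<Longrightarrow> \<phi> \<in> borel_measurable borel"
  and L2_fun_integrable: "\<phi> \<in> L2_fun \<Longrightarrow> integrable lborel (\<lambda>x. (cmod (\<phi> x))\<^sup>2)"
  by (simp_all add: L2_fun_def)

text \<open>The product is dominated by the sum of the two squares. This makes the windowed function
  integrable even when \<open>f\<close> itself is not.\<close>

lemma integrable_gauss_mult_L2_fun: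
  fixes f :: "real^'n::finite \<Rightarrow> complex"
  assumes lam: "lam > 0" and f: "f \<in> L2_fun"
  shows "integrable lborel (\<lambda>x. of_real (exp (- lam / 2 * (norm x)\<^sup>2)) * f x)"
proof (rule Bochner_Integration.integrable_bound)
  have [measurable]: "f \<in> borel_measurable borel" using f by (rule L2_fun_measurable)
  show "integrable lborel (\<lambda>x. exp (- lam * (norm x)\<^sup>2) + (cmod (f x))\<^sup>2)"
    by (intro Bochner_Integration.integrable_add integrable_gauss_vec lam L2_fun_integrable f)
  show "AE x in lborel. norm (of_real (exp (- lam / 2 * (norm x)\<^sup>2)) * f x) \<le> norm (exp (- lam * (norm x)\<^sup>2) + (cmod (f x))\<^sup>2)"
  proof (intro AE_I2)
    fix x :: "real^'n"
    let ?g = "exp (- lam / 2 * (norm x)\<^sup>2)"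
    have g2: "?g\<^sup>2 = exp (- lam * (norm x)\<^sup>2)" by (simp add: power2_eq_square exp_add[symmetric])
    have "2 * (?g * cmod (f x)) \<le> ?g\<^sup>2 + (cmod (f x))\<^sup>2" using sum_squares_bound[of ?g "cmod (f x)"] by simp
    moreover have "0 \<le> ?g * cmod (f x)" by simp
    moreover have "norm (of_real ?g * f x) = ?g * cmod (f x)" by (simp add: norm_mult)
    ultimately show "norm (of_real ?g * f x) \<le> norm (exp (- lam * (norm x)\<^sup>2) + (cmod (f x))\<^sup>2)"
      unfolding g2 real_norm_def by linarith
  qed
  show "(\<lambda>x. of_real (exp (- lam / 2 * (norm x)\<^sup>2)) * f x) \<in> borel_measurable lborel" by measurable
qed

text \<open>The purely imaginary points already suffice: there the transforms are Fourier transforms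
  of the functions times a centred Gaussian, which never vanishes. Integrability of \<open>f\<close>
  and \<open>g\<close> is not assumed because the preimage chosen by \<open>inv_into\<close> is only
  known to lie in \<open>L2_fun\<close>.\<close>

lemma bargmann_inj_AE:
  fixes f g :: "real^'n::finite \<Rightarrow> complex"
  assumes lam: "lam > 0" and f: "f \<in> L2_fun" and g: "g \<in> L2_fun"
    and eq: "bargmann lam f = bargmann lam g"
  shows "AE x in lborel. f x = g x"
proof -
  let ?h = "\<lambda>f x. of_real (exp (- lam / 2 * (norm x)\<^sup>2)) * f x :: complex"
  have i: "integrable lborel (?h f)" "integrable lborel (?h g)"
    using integrable_gauss_mult_L2_fun[OF lam] f g by auto
  have same: "fourier (\<lambda>_. lam) (?h f) v = fourier (\<lambda>_. lam) (?h g) v" for v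
    using fun_cong[OF eq, of "Complex_vec 0 v"] lam unfolding bargmann_eq_fourier by simp
  have "AE x in lborel. ?h f x - ?h g x = 0"
  proof (rule fourier_eq_0_imp_AE_eq_0)
    show "integrable lborel (\<lambda>x. ?h f x - ?h g x)" using i by simp
    fix v :: "real^'n"
    let ?K = "\<lambda>v x::real^'n. exp (\<i> * of_real (\<Sum>k\<in>UNIV. 1 * (v $ k * x $ k)))"
    have mK: "case_prod ?K \<in> borel_measurable (borel \<Otimes>\<^sub>M borel)" by measurable
    have iK: "integrable lborel (\<lambda>x. ?K v x * ?h f x)" "integrable lborel (\<lambda>x. ?K v x * ?h g x)"
      by (rule integrable_bounded_kernel[OF mK _ i(1), of 1], simp) (rule integrable_bounded_kernel[OF mK _ i(2), of 1], simp)
    have resc: "fourier (\<lambda>_. 1) h v = fourier (\<lambda>_. lam) h ((1 / lam) *\<^sub>R v)" for h :: "real^'n \<Rightarrow> complex"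
      using lam by (simp add: fourier_def)
    have "fourier (\<lambda>_. 1) (\<lambda>x. ?h f x - ?h g x) v = fourier (\<lambda>_. 1) (?h f) v - fourier (\<lambda>_. 1) (?h g) v"
      unfolding fourier_def right_diff_distrib[of "exp _"] by (rule Bochner_Integration.integral_diff[OF iK])
    then show "fourier (\<lambda>_. 1) (\<lambda>x. ?h f x - ?h g x) v = 0"
      unfolding resc same by simp
  qed
  then show ?thesis by eventually_elim simp
qed

text \<open>For a fixed real part u, the Fourier estimate bounds the integral over v by the norm of
  the windowed \<phi>. Tonelli then integrates the squared window over its centre u, which
  contributes a constant independent of x.\<close>

lemma bargmann_in_fock_space:
  fixes \<phi> :: "real^'n::finite \<Rightarrow> complex"
  assumes lam: "lam > 0" and \<phi>: "\<phi> \<in> L2_fun" "integrable lborel \<phi>"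
  shows "bargmann lam \<phi> \<in> fock_space lam"
proof -
  have ent: "entire_on_Cn (bargmann lam \<phi>)" by (rule entire_bargmann[OF lam \<phi>(2)])
  have "continuous_on UNIV (bargmann lam \<phi>)"
    using ent unfolding entire_on_Cn_def continuous_on_eq_continuous_at[OF open_UNIV]
    by (metis has_derivative_continuous)
  then have [measurable]: "bargmann lam \<phi> \<in> borel_measurable borel" by (rule borel_measurable_continuous_onI)
  have [measurable]: "\<phi> \<in> borel_measurable borel" using \<phi>(2) by simp
  define f where "f z = (cmod (bargmann lam \<phi> z))\<^sup>2 * exp (- (lam * (norm z)\<^sup>2 / 2))" for z
  have [measurable]: "f \<in> borel_measurable borel" unfolding f_def[abs_def] by measurable
  define C where "C = ((lam / pi) powr (real CARD('n) / 4))\<^sup>2"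
  define D where "D = (\<Prod>k\<in>(UNIV::'n set). 2 * pi / \<bar>lam\<bar>)"
  define D' where "D' = (\<Prod>k\<in>(UNIV::'n set). 2 * pi / \<bar>sqrt lam\<bar>)"
  let ?h = "\<lambda>u x. of_real (exp (- lam / 2 * (norm (x - u))\<^sup>2)) * \<phi> x"
  have h: "integrable lborel (?h u)" for u
    by (rule Bochner_Integration.integrable_bound[OF \<phi>(2)])
      (use lam in \<open>auto intro!: AE_I2 mult_left_le_one_le simp: norm_mult\<close>)
  have gauss: "(\<integral>\<^sup>+u. ennreal (exp (- lam * (norm (x - u))\<^sup>2)) \<partial>lborel) \<le> ennreal D'" for x :: "real^'n"
  proof -
    \<comment> \<open>The Gaussian mass formula is used with e = 1/4 and all scales sqrt lam. Its
      factors sqrt(4 pi) are at least 1 and only enlarge the bound.\<close>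
    have "exp (- lam * (norm (x - u))\<^sup>2) \<le> (\<Prod>k\<in>UNIV. sqrt (pi / (1/4)) * exp (- (sqrt lam * (x $ k - u $ k))\<^sup>2 / (4 * (1/4))))" for u
    proof -
      have "1 \<le> sqrt (pi / (1/4))" using pi_ge_two by simp
      then have "(\<Prod>k\<in>UNIV. exp (- (sqrt lam * (x $ k - u $ k))\<^sup>2)) \<le> (\<Prod>k\<in>UNIV. sqrt (pi / (1/4)) * exp (- (sqrt lam * (x $ k - u $ k))\<^sup>2))"
        by (intro prod_mono) (auto simp: mult_le_cancel_right1)
      moreover have "(\<Prod>k\<in>UNIV. exp (- (sqrt lam * (x $ k - u $ k))\<^sup>2)) = exp (- lam * (norm (x - u))\<^sup>2)"
        using lam by (simp add: exp_sum[symmetric] norm_vec_power2 power_mult_distrib sum_negf sum_distrib_left)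
      ultimately show ?thesis by simp
    qed
    then have "(\<integral>\<^sup>+u. ennreal (exp (- lam * (norm (x - u))\<^sup>2)) \<partial>lborel) \<le>
      (\<integral>\<^sup>+u. ennreal (\<Prod>k\<in>UNIV. sqrt (pi / (1/4)) * exp (- (sqrt lam * (x $ k - u $ k))\<^sup>2 / (4 * (1/4)))) \<partial>lborel)"
      by (intro nn_integral_mono ennreal_leI)
    also have "\<dots> = ennreal D'" unfolding D'_def by (rule nn_integral_gauss_vec) (use lam in auto)
    finally show ?thesis .
  qed
  have "(\<integral>\<^sup>+z. ennreal (f z) \<partial>lborel) = (\<integral>\<^sup>+u. \<integral>\<^sup>+v. ennreal (f (Complex_vec u v)) \<partial>lborel \<partial>lborel)"
    by (rule nn_integral_lborel_complex_vec) measurable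
  also have "\<dots> \<le> (\<integral>\<^sup>+u. ennreal C * (ennreal D * (\<integral>\<^sup>+x. ennreal (exp (- lam * (norm (x - u))\<^sup>2)) * ennreal ((cmod (\<phi> x))\<^sup>2) \<partial>lborel)) \<partial>lborel)"
  proof (rule nn_integral_mono)
    fix u :: "real^'n"
    have sq: "ennreal ((cmod (?h u x))\<^sup>2) = ennreal (exp (- lam * (norm (x - u))\<^sup>2)) * ennreal ((cmod (\<phi> x))\<^sup>2)" for x
      by (simp add: norm_mult power_mult_distrib ennreal_mult[symmetric] power2_eq_square[of "exp _"] exp_add[symmetric])
    have "(\<integral>\<^sup>+v. ennreal (f (Complex_vec u v)) \<partial>lborel) = (\<integral>\<^sup>+v. ennreal C * ennreal ((cmod (fourier (\<lambda>_. lam) (?h u) v))\<^sup>2) \<partial>lborel)"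
      unfolding f_def norm_bargmann_Complex_vec by (simp add: C_def ennreal_mult)
    also have "\<dots> = ennreal C * (\<integral>\<^sup>+v. ennreal ((cmod (fourier (\<lambda>_. lam) (?h u) v))\<^sup>2) \<partial>lborel)"
      by (intro nn_integral_cmult) (use h[of u] in measurable)
    also have "\<dots> \<le> ennreal C * (ennreal D * (\<integral>\<^sup>+x. ennreal ((cmod (?h u x))\<^sup>2) \<partial>lborel))"
      unfolding D_def using lam by (intro mult_left_mono nn_integral_fourier_square_le h) auto
    finally show "(\<integral>\<^sup>+v. ennreal (f (Complex_vec u v)) \<partial>lborel)
      \<le> ennreal C * (ennreal D * (\<integral>\<^sup>+x. ennreal (exp (- lam * (norm (x - u))\<^sup>2)) * ennreal ((cmod (\<phi> x))\<^sup>2) \<partial>lborel))" unfolding sq .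
  qed
  also have "\<dots> = ennreal C * (ennreal D * (\<integral>\<^sup>+u. \<integral>\<^sup>+x. ennreal (exp (- lam * (norm (x - u))\<^sup>2)) * ennreal ((cmod (\<phi> x))\<^sup>2) \<partial>lborel \<partial>lborel))"
    by (simp add: nn_integral_cmult)
  also have "(\<integral>\<^sup>+u. \<integral>\<^sup>+x. ennreal (exp (- lam * (norm (x - u))\<^sup>2)) * ennreal ((cmod (\<phi> x))\<^sup>2) \<partial>lborel \<partial>lborel)
    = (\<integral>\<^sup>+x. \<integral>\<^sup>+u. ennreal (exp (- lam * (norm (x - u))\<^sup>2)) * ennreal ((cmod (\<phi> x))\<^sup>2) \<partial>lborel \<partial>lborel)"
    by (rule lborel_pair.Fubini') measurable
  also have "\<dots> \<le> (\<integral>\<^sup>+x. ennreal D' * ennreal ((cmod (\<phi> x))\<^sup>2) \<partial>lborel)"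
    using gauss by (intro nn_integral_mono) (simp add: nn_integral_multc mult_right_mono)
  also have "\<dots> = ennreal D' * ennreal (LINT x|lborel. (cmod (\<phi> x))\<^sup>2)"
    using nn_integral_eq_integral[OF L2_fun_integrable[OF \<phi>(1)]] by (simp add: nn_integral_cmult)
  finally have "(\<integral>\<^sup>+z. ennreal (f z) \<partial>lborel) \<le> ennreal C * (ennreal D * (ennreal D' * ennreal (LINT x|lborel. (cmod (\<phi> x))\<^sup>2)))"
    by (simp add: mult_left_mono)
  also have "\<dots> < \<infinity>" by (simp add: ennreal_mult_less_top)
  finally have fin: "(\<integral>\<^sup>+z. ennreal (f z) \<partial>lborel) < \<infinity>" .
  have "integrable (fock_measure lam) f"
  proof (rule integrableI_bounded)
    show "f \<in> borel_measurable (fock_measure lam)" by (simp add: fock_measure_def)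
    have "ennreal (norm (f z)) = ennreal (f z)" for z by (simp add: f_def)
    then show "(\<integral>\<^sup>+z. ennreal (norm (f z)) \<partial>fock_measure lam) < \<infinity>"
      using fin by (simp add: fock_measure_def nn_integral_scale_measure ennreal_mult_less_top)
  qed
  with ent show ?thesis by (simp add: fock_space_def f_def[abs_def])
qed

subsection \<open>One coordinate of the kernel\<close>


text \<open>Principal roots of numbers in the right half-plane have |Im| < Re, so the product of two
  of them again has positive real part and must be the principal root of the product.\<close>

lemma csqrt_mult_eq:
  assumes w: "Re w > 0" and p: "Re p > 0" and wp: "w * p = of_real lam" and lam: "lam > 0"
  shows "csqrt w * csqrt p = of_real (sqrt lam)"
proof -
  have pos: "\<bar>Im (csqrt z)\<bar> < Re (csqrt z)" if z: "Re z > 0" for z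
  proof -
    have "Re z = (Re (csqrt z))\<^sup>2 - (Im (csqrt z))\<^sup>2"
      by (metis Re_power2 power2_csqrt)
    then have "\<bar>Im (csqrt z)\<bar> < \<bar>Re (csqrt z)\<bar>" using z by (metis abs_le_square_iff diff_gt_0_iff_gt not_le)
    then show ?thesis using csqrt_principal[of z] by auto
  qed
  have "csqrt (of_real lam) = csqrt w * csqrt p"
  proof (rule csqrt_unique)
    show "(csqrt w * csqrt p)\<^sup>2 = of_real lam" by (simp add: power_mult_distrib wp)
    have "Im (csqrt w) * Im (csqrt p) \<le> \<bar>Im (csqrt w)\<bar> * \<bar>Im (csqrt p)\<bar>" by (metis abs_ge_self abs_mult)
    also have "\<dots> < Re (csqrt w) * Re (csqrt p)" by (intro mult_strict_mono' pos w p) auto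
    finally show "0 < Re (csqrt w * csqrt p) \<or> Re (csqrt w * csqrt p) = 0 \<and> 0 \<le> Im (csqrt w * csqrt p)" by simp
  qed
  moreover have "csqrt (of_real lam) = of_real (sqrt lam)" using csqrt_of_real_nonneg[of "of_real lam"] lam by simp
  ultimately show ?thesis by simp
qed

text \<open>The real part shows that the number under the root is in the open right half-plane as
  soon as sin \<theta> is nonzero.\<close>

lemma one_minus_exp:
  "1 - exp (- 2 * \<i> * of_real \<theta>) = 2 * \<i> * of_real (sin \<theta>) * cis (- \<theta>)"
  "Re (1 - exp (- 2 * \<i> * of_real \<theta>)) = 2 * (sin \<theta>)\<^sup>2"
proof -
  have "exp (- 2 * \<i> * of_real \<theta>) = cis (- (2 * \<theta>))" by (simp add: cis_conv_exp mult_ac)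
  then show "1 - exp (- 2 * \<i> * of_real \<theta>) = 2 * \<i> * of_real (sin \<theta>) * cis (- \<theta>)"
    by (simp add: complex_eq_iff cos_double_sin sin_double power2_eq_square)
  then show "Re (1 - exp (- 2 * \<i> * of_real \<theta>)) = 2 * (sin \<theta>)\<^sup>2"
    by (simp add: power2_eq_square)
qed

text \<open>One coordinate of the computation: \<open>p\<close> and \<open>q\<close> are the coefficients of the Gaussian in \<open>x\<close>
  after the substitution \<open>x \<mapsto> x + a\<close>, and \<open>r\<close> collects the terms that do not depend on \<open>x\<close>.\<close>
lemma gauss_kernel_coordinate:
  fixes lam \<theta> a b y :: real and z :: complex
  assumes lam: "lam > 0" and sin: "sin \<theta> \<noteq> 0"
  defines "p \<equiv> of_real (lam / 2) * (1 - \<i> * of_real (cos \<theta> / sin \<theta>))"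
    and "q \<equiv> of_real lam * (z - Complex a b - \<i> * of_real (y / sin \<theta>))"
    and "r \<equiv> - of_real (lam / 4) * z\<^sup>2 + of_real lam * z * of_real a - of_real (lam / 2 * a\<^sup>2)
        - \<i> * of_real (lam * (a * b) / 2) + \<i> * of_real (lam / 2 * (cos \<theta> / sin \<theta>) * y\<^sup>2)"
  shows "Re p > 0"
    and "of_real (sqrt (lam / pi)) * inverse (csqrt (1 - exp (- 2 * \<i> * of_real \<theta>))) * (of_real (sqrt pi) / csqrt p) = 1"
    and "q\<^sup>2 / (4 * p) + r =
      of_real (lam / 2) * (cnj (Complex a b) * z) - of_real (lam / 4 * (a\<^sup>2 + b\<^sup>2))
      + (- of_real (lam / 4) * (cis (- \<theta>) * (z - Complex a b))\<^sup>2
        + of_real lam * (cis (- \<theta>) * (z - Complex a b)) * of_real y - of_real (lam / 2 * y\<^sup>2))"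
proof -
  define w where "w = 1 - exp (- 2 * \<i> * of_real \<theta>)"
  define s c E where "s = complex_of_real (sin \<theta>)" and "c = complex_of_real (cos \<theta>)" and "E = c - \<i> * s"
  have s0: "s \<noteq> 0" using sin by (simp add: s_def)
  have sc: "s * s + c * c = 1"
    unfolding s_def c_def of_real_mult[symmetric] of_real_add[symmetric] using sin_cos_squared_add[of \<theta>] by (simp add: power2_eq_square)
  have cisE: "cis (- \<theta>) = E" by (simp add: E_def s_def c_def complex_eq_iff)
  have w: "w = 2 * \<i> * s * E" unfolding w_def one_minus_exp(1) cisE s_def ..
  have p: "p = of_real lam / 2 * (1 - \<i> * (c / s))" by (simp add: p_def s_def c_def)
  \<comment> \<open>Both w and p are multiples of exponentials of opposite phase: the factor 1 - i
    cot \<theta> is cis(\<theta>) / (i sin \<theta>).\<close>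
  have wp: "w * p = of_real lam"
  proof -
    have "w * p = of_real lam * (\<i> * E * (s - \<i> * c))" using s0 by (simp add: w p field_simps)
    also have "\<i> * E * (s - \<i> * c) = s * s + c * c" by (simp add: E_def algebra_simps)
    finally show ?thesis by (simp add: sc)
  qed
  show Rep: "Re p > 0" using lam by (simp add: p_def)
  have Rew: "Re w > 0" unfolding w_def one_minus_exp(2) using sin by simp
  have cc: "csqrt w * csqrt p = of_real (sqrt lam)" by (rule csqrt_mult_eq[OF Rew Rep wp lam])
  have "csqrt w \<noteq> 0" "csqrt p \<noteq> 0" using Rep Rew by auto
  moreover have "of_real (sqrt (lam / pi)) * complex_of_real (sqrt pi) = csqrt w * csqrt p"
    unfolding cc of_real_mult[symmetric] real_sqrt_mult[symmetric] by simp
  ultimately show "of_real (sqrt (lam / pi)) * inverse (csqrt (1 - exp (- 2 * \<i> * of_real \<theta>))) * (of_real (sqrt pi) / csqrt p) = 1"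
    unfolding w_def[symmetric] by (simp add: field_simps)
  define L Y A B where "L = complex_of_real lam" and "Y = complex_of_real y" and "A = complex_of_real a" and "B = complex_of_real b"
  have L0: "L \<noteq> 0" using lam by (simp add: L_def)
  define W where "W = z - (A + \<i> * B)"
  have p0: "p \<noteq> 0" using Rep by auto
  have z0: "Complex a b = A + \<i> * B" by (simp add: A_def B_def Complex_eq)
  have q: "q = L * (W - \<i> * Y / s)" unfolding q_def z0 W_def L_def Y_def s_def by simp
  have "q\<^sup>2 / (4 * p) = q\<^sup>2 * w / (4 * L)"
    using p0 L0 wp unfolding L_def by (simp add: frac_eq_eq mult_ac)
  also have "\<dots> = L / 2 * (\<i> * s * E * W\<^sup>2 + 2 * W * Y * E - \<i> * Y\<^sup>2 * E / s)"
    using L0 s0 unfolding q w by (simp add: field_simps power2_eq_square)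
  \<comment> \<open>Splits the coefficient of W^2 into a rotated part, which belongs to the Bargmann
    kernel at the rotated point, and an unrotated part, which combines with \<open>r\<close> to the
    prefactor of the representation.\<close>
  also have "\<i> * s * E = (1 - E\<^sup>2) / 2"
  proof -
    have "1 - E\<^sup>2 = (s * s + c * c) - E\<^sup>2" by (simp add: sc)
    also have "\<dots> = 2 * (\<i> * s * E)" by (simp add: E_def power2_eq_square algebra_simps)
    finally show ?thesis by simp
  qed
  finally have q2: "q\<^sup>2 / (4 * p) = L / 2 * ((1 - E\<^sup>2) / 2 * W\<^sup>2 + 2 * W * Y * E - \<i> * Y\<^sup>2 * E / s)" .
  have r: "r = - (L / 4) * z\<^sup>2 + L * z * A - L / 2 * A\<^sup>2 - \<i> * (L * (A * B) / 2) + \<i> * (L / 2 * (c / s) * Y\<^sup>2)"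
    by (simp add: r_def L_def Y_def A_def B_def c_def s_def)
  \<comment> \<open>Uses i c/s = i E/s - 1: the chirp in y cancels the remaining term with E/s and
    leaves the Gaussian in y of the Bargmann kernel.\<close>
  have cE: "\<i> * (L / 2 * (c / s) * Y\<^sup>2) = L / 2 * (\<i> * Y\<^sup>2 * E / s) - L / 2 * Y\<^sup>2"
    using s0 unfolding E_def by (simp add: field_simps)
  have "q\<^sup>2 / (4 * p) + r = L / 2 * ((A - \<i> * B) * z) - L / 4 * (A\<^sup>2 + B\<^sup>2)
      + (- (L / 4) * (E * W)\<^sup>2 + L * (E * W) * Y - L / 2 * Y\<^sup>2)"
    unfolding q2 r cE W_def by (simp add: field_simps power2_eq_square)
  then show "q\<^sup>2 / (4 * p) + r =
      of_real (lam / 2) * (cnj (Complex a b) * z) - of_real (lam / 4 * (a\<^sup>2 + b\<^sup>2))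
      + (- of_real (lam / 4) * (cis (- \<theta>) * (z - Complex a b))\<^sup>2
        + of_real lam * (cis (- \<theta>) * (z - Complex a b)) * of_real y - of_real (lam / 2 * y\<^sup>2))"
    unfolding cisE z0 W_def[symmetric] by (simp add: L_def Y_def A_def B_def)
qed

subsection \<open>The kernel of the Schroedinger model\<close>


text \<open>The intertwining relation of the two models at the level of kernels, formally its value
  on a point mass at y. The exponent is a sum over coordinates, so the x-integral is a product of
  the one-variable integrals computed above.\<close>

lemma integral_bargmann_kernel_torus_kernel:
  fixes \<alpha> :: "'n::finite \<Rightarrow> real^'m \<Rightarrow> real" and a b y :: "real^'n"
  assumes lam: "lam > 0" and lin: "\<And>k. linear (\<alpha> k)" and sin: "\<And>k. sin (\<alpha> k t) \<noteq> 0"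
  defines "E \<equiv> \<lambda>z x. exp (- of_real (lam / 4) * bilin z z + of_real lam * bilin z (of_real_vec x) - of_real (lam / 2 * (x \<bullet> x)))"
  shows "(LINT x|lborel. E z x * (exp (\<i> * of_real (lam * (c - b \<bullet> x + a \<bullet> b / 2))) * torus_kernel lam \<alpha> chi t (x - a) y))
    = chi t * exp (\<i> * of_real (lam * c) + of_real (lam / 2) * bilin (cnj_vec (Complex_vec a b)) z
            - of_real (lam / 4 * (norm (Complex_vec a b))\<^sup>2)) * E (torus_act \<alpha> (- t) (z - Complex_vec a b)) y"
proof -
  let ?\<theta> = "\<lambda>k. \<alpha> k t"
  define p where "p k = of_real (lam / 2) * (1 - \<i> * of_real (cos (?\<theta> k) / sin (?\<theta> k)))" for k
  define q where "q k = of_real lam * (z $ k - Complex (a $ k) (b $ k) - \<i> * of_real (y $ k / sin (?\<theta> k)))" for k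
  define r where "r k = - of_real (lam / 4) * (z $ k)\<^sup>2 + of_real lam * z $ k * of_real (a $ k) - of_real (lam / 2 * (a $ k)\<^sup>2)
        - \<i> * of_real (lam * (a $ k * b $ k) / 2) + \<i> * of_real (lam / 2 * (cos (?\<theta> k) / sin (?\<theta> k)) * (y $ k)\<^sup>2)" for k
  define T where "T k = of_real (sqrt (lam / pi)) * inverse (csqrt (1 - exp (- 2 * \<i> * of_real (?\<theta> k))))" for k
  define \<zeta> where "\<zeta> = torus_act \<alpha> (- t) (z - Complex_vec a b)"
  define X where "X k = of_real (lam / 2) * (cnj (Complex (a $ k) (b $ k)) * z $ k) - of_real (lam / 4 * ((a $ k)\<^sup>2 + (b $ k)\<^sup>2))
      + (- of_real (lam / 4) * (\<zeta> $ k)\<^sup>2 + of_real lam * \<zeta> $ k * of_real (y $ k) - of_real (lam / 2 * (y $ k)\<^sup>2))" for k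
  have \<zeta>: "\<zeta> $ k = cis (- ?\<theta> k) * (z $ k - Complex (a $ k) (b $ k))" for k
    by (simp add: \<zeta>_def torus_act_def linear_neg[OF lin])
  have Rep: "Re (p k) > 0" for k unfolding p_def by (rule gauss_kernel_coordinate(1)[OF lam sin])
  have T: "T k * (of_real (sqrt pi) / csqrt (p k)) = 1" for k
    unfolding T_def p_def by (rule gauss_kernel_coordinate(2)[OF lam sin])
  have X: "(q k)\<^sup>2 / (4 * p k) + r k = X k" for k
    unfolding X_def \<zeta> p_def q_def r_def by (rule gauss_kernel_coordinate(3)[OF lam sin])
  \<comment> \<open>The normalising power is distributed as one factor sqrt(lam/pi) per
    coordinate.\<close>
  have pw: "complex_of_real ((lam / pi) powr (real CARD('n) / 2)) * (\<Prod>k\<in>UNIV. inverse (csqrt (1 - exp (- 2 * \<i> * of_real (?\<theta> k))))) = (\<Prod>k\<in>UNIV. T k)"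
  proof -
    have "(lam / pi) powr (real CARD('n) / 2) = ((lam / pi) powr (1 / 2)) powr real CARD('n)"
      by (simp add: powr_powr)
    also have "\<dots> = (\<Prod>k\<in>(UNIV::'n set). sqrt (lam / pi))"
      using lam by (simp add: powr_half_sqrt powr_realpow)
    finally show ?thesis by (simp add: T_def prod.distrib)
  qed
  define F where "F x = E z x * (exp (\<i> * of_real (lam * (c - b \<bullet> x + a \<bullet> b / 2))) * torus_kernel lam \<alpha> chi t (x - a) y)" for x
  have [measurable]: "F \<in> borel_measurable borel"
    unfolding F_def[abs_def] E_def torus_kernel_def by measurable
  \<comment> \<open>Translation by \<open>a\<close> removes the shift from the kernel argument; the
    factor 1 matches the scaling lemma for the substitution.\<close>
  have F: "F (a + 1 *\<^sub>R x) = chi t * exp (\<i> * of_real (lam * c)) * (\<Prod>k\<in>UNIV. T k * exp (r k) * exp (- p k * (of_real (x $ k))\<^sup>2 + q k * of_real (x $ k)))" for x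
  proof -
    \<comment> \<open>The seven coordinate sums in the exponent are kept opaque, so that the global
      exponent and the sum of the one-coordinate exponents are compared as linear combinations of
      them.\<close>
    define t1 t2 t3 t4 t5 t6 t7 where "t1 k = z $ k * z $ k" and "t2 k = z $ k * of_real (a $ k + x $ k)"
      and "t3 k = complex_of_real ((a $ k + x $ k) * (a $ k + x $ k))" and "t4 k = complex_of_real (b $ k * (a $ k + x $ k))"
      and "t5 k = complex_of_real (a $ k * b $ k)" and "t6 k = complex_of_real (cos (?\<theta> k) / sin (?\<theta> k) * ((x $ k)\<^sup>2 + (y $ k)\<^sup>2))"
      and "t7 k = complex_of_real (x $ k * y $ k / sin (?\<theta> k))" for k
    note ts = t1_def t2_def t3_def t4_def t5_def t6_def t7_def
    define L where "L = complex_of_real lam"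
    have per: "r k + (- p k * (of_real (x $ k))\<^sup>2 + q k * of_real (x $ k))
       = (- (L / 4)) * t1 k + L * t2 k + (- (L / 2)) * t3 k + (- (\<i> * L)) * t4 k + (\<i> * L / 2) * t5 k + (\<i> * L / 2) * t6 k + (- (\<i> * L)) * t7 k" for k
      unfolding r_def p_def q_def ts L_def using sin[of k]
      by (simp add: Complex_eq field_simps power2_eq_square)
    have sums: "bilin z z = sum t1 UNIV" "bilin z (of_real_vec (a + x)) = sum t2 UNIV"
      "complex_of_real ((a + x) \<bullet> (a + x)) = sum t3 UNIV" "complex_of_real (b \<bullet> (a + x)) = sum t4 UNIV"
      "complex_of_real (a \<bullet> b) = sum t5 UNIV"
      "complex_of_real (\<Sum>k\<in>UNIV. cos (?\<theta> k) / sin (?\<theta> k) * ((x $ k)\<^sup>2 + (y $ k)\<^sup>2)) = sum t6 UNIV"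
      "complex_of_real (\<Sum>k\<in>UNIV. x $ k * y $ k / sin (?\<theta> k)) = sum t7 UNIV"
      unfolding ts bilin_def of_real_vec_def inner_vec_def of_real_sum by simp_all
    have e1: "(- of_real (lam / 4) * bilin z z + of_real lam * bilin z (of_real_vec (a + x)) - of_real (lam / 2 * ((a + x) \<bullet> (a + x))))
        + (\<i> * of_real (lam * (c - b \<bullet> (a + x) + a \<bullet> b / 2)))
        + (of_real (lam / 2) * \<i> * of_real (\<Sum>k\<in>UNIV. cos (?\<theta> k) / sin (?\<theta> k) * ((x $ k)\<^sup>2 + (y $ k)\<^sup>2))
            - of_real lam * \<i> * of_real (\<Sum>k\<in>UNIV. x $ k * y $ k / sin (?\<theta> k)))
       = \<i> * of_real (lam * c) + (\<Sum>k\<in>UNIV. r k + (- p k * (of_real (x $ k))\<^sup>2 + q k * of_real (x $ k)))"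
      unfolding per sum.distrib sum_distrib_left[symmetric] of_real_mult of_real_add of_real_diff of_real_divide sums L_def[symmetric]
      by (simp add: field_simps)
    have "F (a + 1 *\<^sub>R x) = chi t * (\<Prod>k\<in>UNIV. T k) * exp (
        (- of_real (lam / 4) * bilin z z + of_real lam * bilin z (of_real_vec (a + x)) - of_real (lam / 2 * ((a + x) \<bullet> (a + x))))
        + (\<i> * of_real (lam * (c - b \<bullet> (a + x) + a \<bullet> b / 2)))
        + (of_real (lam / 2) * \<i> * of_real (\<Sum>k\<in>UNIV. cos (?\<theta> k) / sin (?\<theta> k) * ((x $ k)\<^sup>2 + (y $ k)\<^sup>2))
            - of_real lam * \<i> * of_real (\<Sum>k\<in>UNIV. x $ k * y $ k / sin (?\<theta> k))))"
      unfolding F_def E_def torus_kernel_def pw[symmetric] exp_add scaleR_one add_diff_cancel_left' by (simp only: mult_ac)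
    also have "\<dots> = chi t * exp (\<i> * of_real (lam * c)) * ((\<Prod>k\<in>UNIV. T k) * (\<Prod>k\<in>UNIV. exp (r k + (- p k * (of_real (x $ k))\<^sup>2 + q k * of_real (x $ k)))))"
      unfolding e1 exp_add[of "\<i> * of_real (lam * c)"] exp_sum[OF finite] by (simp only: mult_ac)
    finally show ?thesis unfolding prod.distrib[symmetric] exp_add[of "r _"] by (simp only: mult.assoc)
  qed
  have i: "integrable lborel (\<lambda>x. T k * exp (r k) * exp (- p k * (of_real x)\<^sup>2 + q k * of_real x))" for k
    using integrable_gauss_poly[OF Rep, of 0 k "q k"] by (intro integrable_mult_right) simp
  have v: "(LINT x|lborel. T k * exp (r k) * exp (- p k * (of_real x)\<^sup>2 + q k * of_real x)) = exp (X k)" for k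
  proof -
    have "(LINT x|lborel. T k * exp (r k) * exp (- p k * (of_real x)\<^sup>2 + q k * of_real x))
        = T k * exp (r k) * (of_real (sqrt pi) / csqrt (p k) * exp ((q k)\<^sup>2 / (4 * p k)))"
      unfolding integral_mult_right_zero integral_gauss_complex[OF Rep] ..
    also have "\<dots> = (T k * (of_real (sqrt pi) / csqrt (p k))) * (exp ((q k)\<^sup>2 / (4 * p k)) * exp (r k))" by (simp only: mult_ac)
    finally show ?thesis unfolding T exp_add[symmetric] X by simp
  qed
  have "(LINT x|lborel. F x) = (LINT x|lborel. F (a + 1 *\<^sub>R x))"
    using integral_lborel_scale[of F 1 a] by simp
  also have "\<dots> = chi t * exp (\<i> * of_real (lam * c)) * (\<Prod>k\<in>UNIV. exp (X k))"
    unfolding F integral_mult_right_zero by (subst integral_lborel_vec_prod) (rule i, simp only: v)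
  also have "(\<Prod>k\<in>UNIV. exp (X k)) = exp (sum X UNIV)" by (simp only: exp_sum[OF finite])
  also have "sum X UNIV = of_real (lam / 2) * bilin (cnj_vec (Complex_vec a b)) z - of_real (lam / 4 * (norm (Complex_vec a b))\<^sup>2)
      + (- of_real (lam / 4) * bilin \<zeta> \<zeta> + of_real lam * bilin \<zeta> (of_real_vec y) - of_real (lam / 2 * (y \<bullet> y)))"
    unfolding X_def norm_Complex_vec bilin_def inner_vec_def cnj_vec_def of_real_vec_def
    by (simp add: sum.distrib sum_subtractf sum_distrib_left sum_negf power2_eq_square mult.assoc distrib_left)
  finally show ?thesis
    unfolding F_def E_def \<zeta>_def[symmetric] mult.assoc exp_add[symmetric]
    by (simp only: add_diff_eq diff_add_eq add.assoc[symmetric])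
qed

text \<open>The kernel is a unimodular factor in x, times a character in (x - a, y), times a chirp
  in y. The image of \<phi> is thus, up to unimodular factors and a constant, a translated Fourier
  transform of a function with the modulus of \<phi>, and the Plancherel inequality applies.\<close>

lemma L2_fun_kernel:
  fixes \<alpha> :: "'n::finite \<Rightarrow> real^'m \<Rightarrow> real" and a b :: "real^'n" and c :: real and chi :: "real^'m \<Rightarrow> complex"
  assumes lam: "lam > 0" and sin: "\<And>k. sin (\<alpha> k t) \<noteq> 0" and \<phi>: "\<phi> \<in> L2_fun" "integrable lborel \<phi>"
  defines "K \<equiv> \<lambda>x y. exp (\<i> * of_real (lam * (c - b \<bullet> x + a \<bullet> b / 2))) * torus_kernel lam \<alpha> chi t (x - a) y"
  shows "(\<lambda>x. LINT y|lborel. K x y * \<phi> y) \<in> L2_fun"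
proof -
  define T where "T = of_real ((lam / pi) powr (real CARD('n) / 2)) * chi t
     * (\<Prod>k\<in>UNIV. inverse (csqrt (1 - exp (- 2 * \<i> * of_real (\<alpha> k t)))))"
  define h where "h y = exp (\<i> * of_real (lam / 2 * (\<Sum>k\<in>UNIV. cos (\<alpha> k t) / sin (\<alpha> k t) * (y $ k)\<^sup>2))) * \<phi> y" for y
  \<comment> \<open>The frequency scales are the coefficients of the mixed terms x_k y_k in the
    exponent.\<close>
  define d where "d k = - (lam / sin (\<alpha> k t))" for k
  define g where "g x = exp (\<i> * of_real (lam * (c - b \<bullet> x + a \<bullet> b / 2)
      + lam / 2 * (\<Sum>k\<in>UNIV. cos (\<alpha> k t) / sin (\<alpha> k t) * ((x - a) $ k)\<^sup>2)))" for x
  have [measurable]: "\<phi> \<in> borel_measurable borel" using \<phi>(2) by simp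
  have [measurable]: "h \<in> borel_measurable borel" unfolding h_def[abs_def] by measurable
  have [measurable]: "g \<in> borel_measurable borel" unfolding g_def[abs_def] by measurable
  have nh: "cmod (h y) = cmod (\<phi> y)" for y by (simp add: h_def norm_mult)
  have h: "integrable lborel h"
    by (rule Bochner_Integration.integrable_bound[OF \<phi>(2)]) (auto simp: nh)
  have [measurable]: "fourier d h \<in> borel_measurable borel" by (rule borel_measurable_fourier[OF h])
  have eq: "(LINT y|lborel. K x y * \<phi> y) = T * g x * fourier d h (x - a)" for x
  proof -
    have "K x y * \<phi> y = T * g x * (exp (\<i> * of_real (\<Sum>k\<in>UNIV. d k * ((x - a) $ k * y $ k))) * h y)" for y
    proof -
      let ?ct = "\<lambda>k. cos (\<alpha> k t) / sin (\<alpha> k t)"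
      have s1: "(\<Sum>k\<in>UNIV. ?ct k * (((x - a) $ k)\<^sup>2 + (y $ k)\<^sup>2))
          = (\<Sum>k\<in>UNIV. ?ct k * ((x - a) $ k)\<^sup>2) + (\<Sum>k\<in>UNIV. ?ct k * (y $ k)\<^sup>2)"
        by (simp only: distrib_left sum.distrib)
      have s2: "(\<Sum>k\<in>UNIV. d k * ((x - a) $ k * y $ k)) = - (lam * (\<Sum>k\<in>UNIV. (x - a) $ k * y $ k / sin (\<alpha> k t)))"
        by (simp add: d_def sum_distrib_left sum_negf)
      let ?S1 = "\<Sum>k\<in>UNIV. ?ct k * ((x - a) $ k)\<^sup>2" and ?S2 = "\<Sum>k\<in>UNIV. ?ct k * (y $ k)\<^sup>2"
        and ?S3 = "\<Sum>k\<in>UNIV. (x - a) $ k * y $ k / sin (\<alpha> k t)" and ?s = "lam * (c - b \<bullet> x + a \<bullet> b / 2)"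
      have "K x y * \<phi> y = T * (exp (\<i> * of_real ?s) * exp (of_real (lam / 2) * \<i> * of_real (?S1 + ?S2) - of_real lam * \<i> * of_real ?S3)) * \<phi> y"
        unfolding K_def torus_kernel_def T_def s1 by (simp only: mult_ac)
      also have "exp (\<i> * of_real ?s) * exp (of_real (lam / 2) * \<i> * of_real (?S1 + ?S2) - of_real lam * \<i> * of_real ?S3)
          = exp (\<i> * of_real (?s + lam / 2 * ?S1)) * (exp (\<i> * of_real (- (lam * ?S3))) * exp (\<i> * of_real (lam / 2 * ?S2)))"
        unfolding exp_add[symmetric] by (rule arg_cong[where f=exp]) (simp add: algebra_simps)
      finally show ?thesis unfolding g_def h_def s2 by (simp only: mult_ac)
    qed
    then show ?thesis unfolding fourier_def by (simp only: integral_mult_right_zero)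
  qed
  have ng: "cmod (T * g x * w) = cmod T * cmod w" for x w by (simp add: g_def norm_mult)
  have d0: "d k \<noteq> 0" for k using lam sin[of k] by (simp add: d_def)
  have "(\<integral>\<^sup>+x. ennreal ((cmod (T * g x * fourier d h (x - a)))\<^sup>2) \<partial>lborel)
      = (\<integral>\<^sup>+x. ennreal ((cmod T)\<^sup>2) * ennreal ((cmod (fourier d h (x - a)))\<^sup>2) \<partial>lborel)"
    unfolding ng by (simp add: power_mult_distrib ennreal_mult)
  also have "\<dots> = ennreal ((cmod T)\<^sup>2) * (\<integral>\<^sup>+x. ennreal ((cmod (fourier d h (- a + x)))\<^sup>2) \<partial>lborel)"
    by (subst nn_integral_cmult) simp_all
  also have "(\<integral>\<^sup>+x. ennreal ((cmod (fourier d h (- a + x)))\<^sup>2) \<partial>lborel) = (\<integral>\<^sup>+x. ennreal ((cmod (fourier d h x))\<^sup>2) \<partial>lborel)"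
    by (subst (2) lborel_distr_plus[of "- a", symmetric]) (simp add: nn_integral_distr)
  also have "ennreal ((cmod T)\<^sup>2) * \<dots> \<le> ennreal ((cmod T)\<^sup>2) * (ennreal (\<Prod>k\<in>UNIV. 2 * pi / \<bar>d k\<bar>) * (\<integral>\<^sup>+x. ennreal ((cmod (h x))\<^sup>2) \<partial>lborel))"
    by (intro mult_left_mono nn_integral_fourier_square_le d0 h) simp
  also have "\<dots> < \<infinity>"
    using nn_integral_eq_integral[OF L2_fun_integrable[OF \<phi>(1)]] by (simp add: nh ennreal_mult_less_top)
  finally have fin: "(\<integral>\<^sup>+x. ennreal ((cmod (T * g x * fourier d h (x - a)))\<^sup>2) \<partial>lborel) < \<infinity>" .
  have m: "(\<lambda>x. T * g x * fourier d h (x - a)) \<in> borel_measurable lborel" by measurable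
  then have "integrable lborel (\<lambda>x. (cmod (T * g x * fourier d h (x - a)))\<^sup>2)"
    using fin by (intro integrableI_bounded) auto
  with m show ?thesis unfolding eq by (simp add: L2_fun_def)
qed

lemma schroedinger_kernel:
  fixes \<alpha> :: "'n::finite \<Rightarrow> real^'m \<Rightarrow> real" and a b :: "real^'n"
  assumes lam: "lam > 0" and lin: "\<And>k. linear (\<alpha> k)" and sin: "\<And>k. sin (\<alpha> k t) \<noteq> 0"
  shows "has_kernel (schroedinger_rep lam \<alpha> chi (t, Complex_vec a b, c))
           (\<lambda>x y. exp (\<i> * of_real (lam * (c - b \<bullet> x + a \<bullet> b / 2))) * torus_kernel lam \<alpha> chi t (x - a) y)"
proof -
  define K where "K x y = exp (\<i> * of_real (lam * (c - b \<bullet> x + a \<bullet> b / 2))) * torus_kernel lam \<alpha> chi t (x - a) y" for x y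
  \<comment> \<open>All exponents in the kernel are purely imaginary, so this is its exact modulus
    everywhere.\<close>
  define B where "B = cmod (of_real ((lam / pi) powr (real CARD('n) / 2)) * chi t
     * (\<Prod>k\<in>UNIV. inverse (csqrt (1 - exp (- 2 * \<i> * of_real (\<alpha> k t))))))"
  have mK: "case_prod K \<in> borel_measurable (borel \<Otimes>\<^sub>M borel)"
    unfolding K_def[abs_def] torus_kernel_def by measurable
  have nK: "cmod (K x y) \<le> B" for x y
    unfolding K_def torus_kernel_def B_def norm_mult by simp
  let ?E = "\<lambda>z x. exp (- of_real (lam / 4) * bilin z z + of_real lam * bilin z (of_real_vec x) - of_real (lam / 2 * (x \<bullet> x)))"
  have iE: "integrable lborel (?E z)" for z :: "complex^'n"
  proof (rule Bochner_Integration.integrable_bound)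
    show "integrable lborel (\<lambda>x::real^'n. exp (- of_real (lam / 4) * bilin z z) * of_real (exp (lam * (norm z)\<^sup>2) * exp (- (lam / 4) * (norm x)\<^sup>2)))"
      using integrable_gauss_vec[of "lam / 4"] lam by (intro integrable_mult_right integrable_of_real) simp
    show "AE x in lborel. norm (?E z x) \<le> norm (exp (- of_real (lam / 4) * bilin z z) * complex_of_real (exp (lam * (norm z)\<^sup>2) * exp (- (lam / 4) * (norm x)\<^sup>2)))"
    proof (intro AE_I2)
      fix x :: "real^'n"
      have r: "Re (bilin z (of_real_vec x)) \<le> norm z * norm x"
        using bilin_of_real_vec_bound[of z x] complex_Re_le_cmod[of "bilin z (of_real_vec x)"] by linarith
      \<comment> \<open>Weighted so that half of the Gaussian decay in x survives the linear
        term.\<close>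
      have "norm z * norm x \<le> (norm z)\<^sup>2 + (norm x)\<^sup>2 / 4"
        using zero_le_power2[of "norm z - norm x / 2"] by (simp add: power2_eq_square algebra_simps)
      with r have "lam * Re (bilin z (of_real_vec x)) \<le> lam * ((norm z)\<^sup>2 + (norm x)\<^sup>2 / 4)"
        using lam by (intro mult_left_mono) auto
      then have "Re (- of_real (lam / 4) * bilin z z + of_real lam * bilin z (of_real_vec x) - of_real (lam / 2 * (x \<bullet> x)))
         \<le> Re (- of_real (lam / 4) * bilin z z) + (lam * (norm z)\<^sup>2 + - (lam / 4) * (norm x)\<^sup>2)"
        by (simp add: dot_square_norm algebra_simps)
      then show "norm (?E z x) \<le> norm (exp (- of_real (lam / 4) * bilin z z) * complex_of_real (exp (lam * (norm z)\<^sup>2) * exp (- (lam / 4) * (norm x)\<^sup>2)))"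
        unfolding norm_mult norm_of_real norm_exp_eq_Re abs_mult abs_exp_cancel exp_add[symmetric] by simp
    qed
  qed measurable
  show ?thesis
    unfolding has_kernel_def K_def[symmetric]
  proof (intro ballI impI conjI allI)
    fix \<phi> :: "real^'n \<Rightarrow> complex" and x :: "real^'n"
    assume "integrable lborel \<phi>"
    then show "integrable lborel (\<lambda>y. K x y * \<phi> y)" by (rule integrable_bounded_kernel[OF mK nK])
  next
    fix \<phi> :: "real^'n \<Rightarrow> complex"
    assume \<phi>: "\<phi> \<in> L2_fun" "integrable lborel \<phi>"
    define \<psi> where "\<psi> x = (LINT y|lborel. K x y * \<phi> y)" for x
    have \<psi>: "\<psi> \<in> L2_fun"
      unfolding \<psi>_def[abs_def] K_def by (rule L2_fun_kernel[where \<alpha>=\<alpha> and t=t, OF lam sin \<phi>])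
    have "bargmann lam \<psi> = fock_rep lam \<alpha> chi (t, Complex_vec a b, c) (bargmann lam \<phi>)"
    proof
      fix z
      let ?C = "complex_of_real ((lam / pi) powr (real CARD('n) / 4))"
      let ?\<zeta> = "torus_act \<alpha> (- t) (z - Complex_vec a b)"
      let ?M = "chi t * exp (\<i> * of_real (lam * c) + of_real (lam / 2) * bilin (cnj_vec (Complex_vec a b)) z
            - of_real (lam / 4 * (norm (Complex_vec a b))\<^sup>2))"
      have "bargmann lam \<psi> z = ?C * (LINT x|lborel. ?E z x * (LINT y|lborel. K x y * \<phi> y))"
        by (simp only: bargmann_def \<psi>_def)
      also have "(LINT x|lborel. ?E z x * (LINT y|lborel. K x y * \<phi> y)) = (LINT y|lborel. (LINT x|lborel. ?E z x * K x y) * \<phi> y)"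
        by (rule integral_swap_bounded_kernel[OF mK nK \<phi>(2) iE])
      also have "\<dots> = (LINT y|lborel. ?M * (?E ?\<zeta> y * \<phi> y))"
        unfolding K_def integral_bargmann_kernel_torus_kernel[where \<alpha>=\<alpha>, OF lam lin sin] by (simp only: mult.assoc)
      also have "?C * \<dots> = ?M * bargmann lam \<phi> ?\<zeta>"
        unfolding bargmann_def integral_mult_right_zero by (rule mult.left_commute)
      \<comment> \<open>\<open>fock_rep\<close> is restricted to the Fock space, so its formula is
        available only after membership of the transform is known.\<close>
      also have "\<dots> = fock_rep lam \<alpha> chi (t, Complex_vec a b, c) (bargmann lam \<phi>) z"
        using bargmann_in_fock_space[OF lam \<phi>] by (simp add: fock_rep_def)
      finally show "bargmann lam \<psi> z = fock_rep lam \<alpha> chi (t, Complex_vec a b, c) (bargmann lam \<phi>) z" .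
    qed
    then have s: "schroedinger_rep lam \<alpha> chi (t, Complex_vec a b, c) \<phi> = inv_into L2_fun (bargmann lam) (bargmann lam \<psi>)"
      by (simp add: schroedinger_rep_def)
    have im: "bargmann lam \<psi> \<in> bargmann lam ` L2_fun" using \<psi> by (rule imageI)
    show "AE x in lborel. schroedinger_rep lam \<alpha> chi (t, Complex_vec a b, c) \<phi> x = (LINT y|lborel. K x y * \<phi> y)"
      \<comment> \<open>The preimage selected by \<open>inv_into\<close> and \<psi> have the same
        Bargmann transform, hence agree almost everywhere.\<close>
      unfolding s \<psi>_def[symmetric]
      by (rule bargmann_inj_AE[OF lam inv_into_into[OF im] \<psi> f_inv_into_f[OF im]])
  qed
qed

theorem corollary8p2:
  fixes lam :: real
    and \<alpha> :: "'n::finite \<Rightarrow> real^'m \<Rightarrow> real"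
    and chi :: "real^'m \<Rightarrow> complex"
    and g :: "(real^'m) \<times> (complex^'n) \<times> real"
    and t :: "real^'m" and a b :: "real^'n" and c :: real
  assumes "lam > 0"
    and "\<And>k. linear (\<alpha> k)"
    and "unitary_character chi"
    and "g \<in> carrier (diamond_group \<alpha>)"
    and "g = (t, Complex_vec a b, c)"
    and "\<And>k. \<alpha> k t \<notin> {pi * of_int j | j. True}"
  shows "has_kernel (schroedinger_rep lam \<alpha> chi g)
           (\<lambda>x y. exp (\<i> * of_real (lam * (c - b \<bullet> x + a \<bullet> b / 2)))
                  * torus_kernel lam \<alpha> chi t (x - a) y)"
proof -
  have "sin (\<alpha> k t) \<noteq> 0" for k
    using assms(6)[of k] by (auto simp: sin_zero_iff_int2 mult.commute)
  with assms(1,2) show ?thesis unfolding assms(5) by (rule schroedinger_kernel)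
qed

end
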